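(* For any $0<\alpha<2$ and $0<\beta\le1$, the generalized grey Brownian motion $\{B_{\alpha,\beta}(t)\}_{t\ge0}$ is self-similar with stationary increments ($H$-sssi), with $H=\alpha/2$. That is: (i) for every $a>0$ the processes $\{B_{\alpha,\beta}(at)\}_{t\ge0}$ and $\{a^{\alpha/2}B_{\alpha,\beta}(t)\}_{t\ge0}$ have the same finite-dimensional distributions; (ii) for every $h\ge0$ the processes $\{B_{\alpha,\beta}(t+h)-B_{\alpha,\beta}(h)\}_{t\ge0}$ and $\{B_{\alpha,\beta}(t)-B_{\alpha,\beta}(0)\}_{t\ge0}$ have the same finite-dimensional distributions.
   Context: $\mathcal{S}(\mathbb{R})$ is the (real-valued) Schwartz space, a nuclear space, and $\mathcal{S}'(\mathbb{R})$ is its dual, with pairing $\langle\cdot,\cdot\rangle$. $\mathcal{B}$ is the Borel $\sigma$-algebra of the weak topology on $\mathcal{S}'(\mathbb{R})$, i.e. the coarsest topology making $\omega\mapsto\langle\omega,\xi\rangle$ continuous for every $\xi\in\mathcal{S}(\mathbb{R})$. The Fourier transform is $\widetilde f(x)=\frac{1}{\sqrt{2\pi}}\int_{\mathbb{R}}e^{ixy}f(y)\,dy$. For $0<\alpha<2$ set $C(\alpha)=\Gamma(\alpha+1)\sin\frac{\pi\alpha}{2}$ and $$(\xi,\eta)_\alpha=C(\alpha)\int_{\mathbb{R}}\overline{\widetilde\xi(x)}\,\widetilde\eta(x)\,|x|^{1-\alpha}dx,\qquad \|\xi\|_\alpha^2=(\xi,\xi)_\alpha .$$ $\mathcal{S}_0^{(\alpha)}(\mathbb{R})$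 is the completion of $\mathcal{S}(\mathbb{R})$ with respect to $\|\cdot\|_\alpha$. For each $t\ge0$ the indicator function $1_{[0,t)}$ (with $\widetilde 1_{[0,t)}(x)=\frac{1}{\sqrt{2\pi}}\frac{e^{itx}-1}{ix}$) belongs to $\mathcal{S}_0^{(\alpha)}(\mathbb{R})$, and $\|1_{[0,t)}\|_\alpha^2=t^\alpha$. For $\beta>0$ the Mittag-Leffler function is $E_\beta(x)=\sum_{n=0}^\infty \frac{x^n}{\Gamma(\beta n+1)}$, $x\in\mathbb{R}$. For $0<\beta\le1$ the function $t\mapsto E_\beta(-t)$, $t\ge0$, is completely monotone. By Minlos' theorem there is a unique probability measure $\mu_{\alpha,\beta}$ on $(\mathcal{S}'(\mathbb{R}),\mathcal{B})$ with $$\int_{\mathcal{S}'(\mathbb{R})}e^{i\langle\omega,\xi\rangle}d\mu_{\alpha,\beta}(\omega)=E_\beta(-\|\xi\|_\alpha^2),\qquad \xi\in\mathcal{S}(\mathbb{R}).$$ The generalized grey noise $X_{\alpha,\beta}$ is defined on this probability space by $X_{\alpha,\beta}(\varphi)(\omega)=\langle\omega,\varphi\rangle$ for $\varphi\in\mathcal{S}(\mathbb{R})$. For $h\in\mathcal{S}_0^{(\alpha)}(\mathbb{R})$, $X_{\alpha,\beta}(h)$ is the limit in $L^2(\mathcal{S}'(\mathbb{R}),\mu_{\alpha,\beta})$ of $X_{\alpha,\beta}(\xi_n)$ for any sequence $\xi_n\in\mathcal{S}(\mathbb{R})$ converging to $h$ in $\|\cdot\|_\alpha$. The generalized grey Brownian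 motion is the process $B_{\alpha,\beta}(t)=X_{\alpha,\beta}(1_{[0,t)})$, $t\ge0$. *)

theory Defs
  imports "HOL-Probability.Probability"
begin

section \<open>The Schwartz space and its dual\<close>

definition schwartz :: "(real \<Rightarrow> real) set" where
  "schwartz = {f. (\<forall>n x. (deriv ^^ n) f differentiable (at x)) \<and>
                  (\<forall>m n. bounded (range (\<lambda>x. x ^ m * (deriv ^^ n) f x)))}"

definition schwartz_seminorm :: "nat \<Rightarrow> nat \<Rightarrow> (real \<Rightarrow> real) \<Rightarrow> real" where
  "schwartz_seminorm m n f = (SUP x. \<bar>x ^ m * (deriv ^^ n) f x\<bar>)"

definition schwartz_topology :: "(real \<Rightarrow> real) topology" where
  "schwartz_topology = topology_generated_by
     {{g \<in> schwartz. schwartz_seminorm m n (\<lambda>x. g x - f x) < e} | f m n e. f \<in> schwartz \<and> e > 0}"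

text \<open>A functional is a function on all of \<^typ>\<open>real \<Rightarrow> real\<close>; extensionality fixes its
  (irrelevant) values outside \<^const>\<open>schwartz\<close>, so that equality of functionals is equality on
  \<^const>\<open>schwartz\<close>. The pairing of \<open>\<omega>\<close> and \<open>\<xi>\<close> is the application \<open>\<omega> \<xi>\<close>.\<close>

definition schwartz_dual :: "((real \<Rightarrow> real) \<Rightarrow> real) set" where
  "schwartz_dual = {\<omega> \<in> extensional schwartz.
     (\<forall>f\<in>schwartz. \<forall>g\<in>schwartz. \<omega> (\<lambda>x. f x + g x) = \<omega> f + \<omega> g) \<and>
     (\<forall>c. \<forall>f\<in>schwartz. \<omega> (\<lambda>x. c * f x) = c * \<omega> f) \<and>
     continuous_map schwartz_topology euclideanreal \<omega>}"

definition weak_topology :: "((real \<Rightarrow> real) \<Rightarrow> real) topology" where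
  "weak_topology = topology_generated_by
     {{\<omega> \<in> schwartz_dual. \<omega> \<xi> \<in> U} | \<xi> U. \<xi> \<in> schwartz \<and> open U}"

definition weak_borel :: "((real \<Rightarrow> real) \<Rightarrow> real) measure" where
  "weak_borel = sigma schwartz_dual {U. openin weak_topology U}"

section \<open>The norms and the completion\<close>

definition fourier :: "(real \<Rightarrow> real) \<Rightarrow> real \<Rightarrow> complex" where
  "fourier f x = complex_of_real (1 / sqrt (2 * pi)) *
     (LINT y|lborel. iexp (x * y) * complex_of_real (f y))"

definition C_alpha :: "real \<Rightarrow> real" where
  "C_alpha \<alpha> = Gamma (\<alpha> + 1) * sin (pi * \<alpha> / 2)"

definition weighted_inner :: "real \<Rightarrow> (real \<Rightarrow> complex) \<Rightarrow> (real \<Rightarrow> complex) \<Rightarrow> complex" where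
  "weighted_inner \<alpha> u v = complex_of_real (C_alpha \<alpha>) *
     (LINT x|lborel. cnj (u x) * v x * complex_of_real (\<bar>x\<bar> powr (1 - \<alpha>)))"

definition weighted_norm :: "real \<Rightarrow> (real \<Rightarrow> complex) \<Rightarrow> real" where
  "weighted_norm \<alpha> u = sqrt (Re (weighted_inner \<alpha> u u))"

definition weighted_L2 :: "real \<Rightarrow> (real \<Rightarrow> complex) set" where
  "weighted_L2 \<alpha> = {u \<in> borel_measurable lborel.
     integrable lborel (\<lambda>x. (cmod (u x))\<^sup>2 * \<bar>x\<bar> powr (1 - \<alpha>))}"

definition alpha_inner :: "real \<Rightarrow> (real \<Rightarrow> real) \<Rightarrow> (real \<Rightarrow> real) \<Rightarrow> complex" where
  "alpha_inner \<alpha> \<xi> \<eta> = weighted_inner \<alpha> (fourier \<xi>) (fourier \<eta>)"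

definition alpha_norm :: "real \<Rightarrow> (real \<Rightarrow> real) \<Rightarrow> real" where
  "alpha_norm \<alpha> \<xi> = sqrt (Re (alpha_inner \<alpha> \<xi> \<xi>))"

text \<open>The Fourier transform is, by definition of \<^const>\<open>alpha_norm\<close>, an isometry of the
  Schwartz space into the space \<^const>\<open>weighted_L2\<close>, which is complete. The completion of the
  Schwartz space is therefore realised as the closure of its image: an element \<open>h\<close> of the
  completion is represented by its Fourier transform \<open>u\<close> (up to equality almost everywhere). In
  particular an integrable \<open>h\<close>, such as an indicator function, is represented by
  \<^term>\<open>fourier h\<close>.\<close>

definition alpha_tendsto :: "real \<Rightarrow> (nat \<Rightarrow> real \<Rightarrow> real) \<Rightarrow> (real \<Rightarrow> complex) \<Rightarrow> bool" where
  "alpha_tendsto \<alpha> \<xi> u \<longleftrightarrow>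
     (\<lambda>n. weighted_norm \<alpha> (\<lambda>x. fourier (\<xi> n) x - u x)) \<longlonglongrightarrow> 0"

definition schwartz_completion :: "real \<Rightarrow> (real \<Rightarrow> complex) set" where
  "schwartz_completion \<alpha> =
     {u \<in> weighted_L2 \<alpha>. \<exists>\<xi>. (\<forall>n. \<xi> n \<in> schwartz) \<and> alpha_tendsto \<alpha> \<xi> u}"

section \<open>Generalized grey noise and generalized grey Brownian motion\<close>

definition mittag_leffler :: "real \<Rightarrow> real \<Rightarrow> real" where
  "mittag_leffler \<beta> x = (\<Sum>n. x ^ n / Gamma (\<beta> * real n + 1))"

text \<open>By Minlos' theorem exactly one measure satisfies the following predicate
  if \<open>0 < \<alpha> < 2\<close> and \<open>0 < \<beta> \<le> 1\<close>.\<close>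

definition grey_noise_measure ::
    "real \<Rightarrow> real \<Rightarrow> ((real \<Rightarrow> real) \<Rightarrow> real) measure \<Rightarrow> bool" where
  "grey_noise_measure \<alpha> \<beta> \<mu> \<longleftrightarrow> prob_space \<mu> \<and> sets \<mu> = sets weak_borel \<and>
     (\<forall>\<xi>\<in>schwartz. (LINT \<omega>|\<mu>. iexp (\<omega> \<xi>)) =
        complex_of_real (mittag_leffler \<beta> (- ((alpha_norm \<alpha> \<xi>)\<^sup>2))))"

definition L2 :: "'a measure \<Rightarrow> ('a \<Rightarrow> real) set" where
  "L2 M = {Y \<in> borel_measurable M. integrable M (\<lambda>\<omega>. (Y \<omega>)\<^sup>2)}"

definition L2_tendsto :: "'a measure \<Rightarrow> (nat \<Rightarrow> 'a \<Rightarrow> real) \<Rightarrow> ('a \<Rightarrow> real) \<Rightarrow> bool" where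
  "L2_tendsto M X Y \<longleftrightarrow> (\<forall>n. X n \<in> L2 M) \<and> Y \<in> L2 M \<and>
     (\<lambda>n. LINT \<omega>|M. (X n \<omega> - Y \<omega>)\<^sup>2) \<longlonglongrightarrow> 0"

text \<open>The limit is unique up to \<open>\<mu>\<close>-null sets when \<open>u\<close> lies in
  \<^const>\<open>schwartz_completion\<close>; a representative is chosen.\<close>

definition grey_noise ::
    "real \<Rightarrow> ((real \<Rightarrow> real) \<Rightarrow> real) measure \<Rightarrow> (real \<Rightarrow> complex) \<Rightarrow>
     ((real \<Rightarrow> real) \<Rightarrow> real) \<Rightarrow> real" where
  "grey_noise \<alpha> \<mu> u = (SOME Y. u \<in> schwartz_completion \<alpha> \<and>
     (\<forall>\<xi>. (\<forall>n. \<xi> n \<in> schwartz) \<and> alpha_tendsto \<alpha> \<xi> u \<longrightarrow>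
        L2_tendsto \<mu> (\<lambda>n \<omega>. \<omega> (\<xi> n)) Y))"

definition grey_Brownian_motion ::
    "real \<Rightarrow> ((real \<Rightarrow> real) \<Rightarrow> real) measure \<Rightarrow> real \<Rightarrow> ((real \<Rightarrow> real) \<Rightarrow> real) \<Rightarrow> real" where
  "grey_Brownian_motion \<alpha> \<mu> t = grey_noise \<alpha> \<mu> (fourier (indicat_real {0..<t}))"

section \<open>Self-similar processes with stationary increments\<close>

text \<open>Processes are indexed by \<open>t \<ge> 0\<close>; their values at \<open>t < 0\<close> are irrelevant. Measurability is
  demanded explicitly because \<^const>\<open>distr\<close> is meaningful only for measurable maps.\<close>

definition same_fdd :: "'a measure \<Rightarrow> (real \<Rightarrow> 'a \<Rightarrow> real) \<Rightarrow> (real \<Rightarrow> 'a \<Rightarrow> real) \<Rightarrow> bool" where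
  "same_fdd M X Y \<longleftrightarrow>
     (\<forall>t\<ge>0. X t \<in> borel_measurable M) \<and> (\<forall>t\<ge>0. Y t \<in> borel_measurable M) \<and>
     (\<forall>J. finite J \<and> J \<subseteq> {0..} \<longrightarrow>
        distr M (\<Pi>\<^sub>M t\<in>J. borel) (\<lambda>\<omega>. \<lambda>t\<in>J. X t \<omega>) =
        distr M (\<Pi>\<^sub>M t\<in>J. borel) (\<lambda>\<omega>. \<lambda>t\<in>J. Y t \<omega>))"

definition self_similar :: "real \<Rightarrow> 'a measure \<Rightarrow> (real \<Rightarrow> 'a \<Rightarrow> real) \<Rightarrow> bool" where
  "self_similar H M X \<longleftrightarrow>
     (\<forall>a>0. same_fdd M (\<lambda>t \<omega>. X (a * t) \<omega>) (\<lambda>t \<omega>. a powr H * X t \<omega>))"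

definition stationary_increments :: "'a measure \<Rightarrow> (real \<Rightarrow> 'a \<Rightarrow> real) \<Rightarrow> bool" where
  "stationary_increments M X \<longleftrightarrow>
     (\<forall>h\<ge>0. same_fdd M (\<lambda>t \<omega>. X (t + h) \<omega> - X h \<omega>) (\<lambda>t \<omega>. X t \<omega> - X 0 \<omega>))"

definition sssi :: "real \<Rightarrow> 'a measure \<Rightarrow> (real \<Rightarrow> 'a \<Rightarrow> real) \<Rightarrow> bool" where
  "sssi H M X \<longleftrightarrow> self_similar H M X \<and> stationary_increments M X"

end

theory Submission
  imports Defs "HOL-Real_Asymp.Real_Asymp"
begin

text \<open>Finite-dimensional distributions are determined by the characteristic functions of the linear
  combinations \<open>\<Sum>\<^sub>j c\<^sub>j B(t\<^sub>j)\<close>. Such a combination is the \<open>L\<^sup>2\<close> limit of pairings with Schwartz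
  functions, so its characteristic function is \<open>E\<^sub>\<beta>(-\<parallel>f\<parallel>\<^sub>\<alpha>\<^sup>2)\<close> with \<open>f\<close> the same combination of the
  indicator functions of \<open>[0, t\<^sub>j)\<close>. Both claims thus reduce to properties of the norm: dilating time by \<open>a\<close> multiplies its square by \<open>a\<^sup>\<alpha>\<close>,
  and translating time by \<open>h\<close> multiplies the Fourier transforms by the unimodular factor \<open>e\<^sup>i\<^sup>h\<^sup>x\<close>.

  The limits exist because the behaviour of the characteristic function at \<open>0\<close> bounds the second
  moment of \<open>\<langle>\<omega>, \<xi>\<rangle>\<close> by a multiple of \<open>\<parallel>\<xi>\<parallel>\<^sub>\<alpha>\<^sup>2\<close>. Indicator functions lie in the completion
  since mollifying them with a Gaussian of variance \<open>\<sigma>\<^sup>2\<close> multiplies their Fourier transform by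
  \<open>exp (- \<sigma>\<^sup>2 x\<^sup>2 / 2)\<close>.\<close>

text \<open>The one-dimensional uniqueness theorem is lifted to several coordinates by letting the
  indicator factors already obtained act as a density. The phase of the remaining coordinates is no
  nonnegative weight; this is why trigonometric weights and a second frequency appear below.

  For the L2 limits an upper bound on second moments is enough, and it depends only on the slope of
  E_\<beta> at 0: as 1 - E_\<beta>(-r) behaves like r / Gamma(\<beta> + 1) for small r, the second
  moment of a pairing is at most 2 / Gamma(\<beta> + 1) times the squared norm.

  The range 0 < \<alpha> < 2 enters through the weight |x|^(1-\<alpha>). The transform of an
  indicator decays only like 1/|x|, so its square against the weight is integrable at infinity
  because \<alpha> > 0, while \<alpha> < 2 gives integrability at the origin. The same range makes
  C(\<alpha>) positive.\<close>

section \<open>Characteristic functions and finite-dimensional distributions\<close>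

text \<open>After division by the common total mass \<open>m\<close>, read off at
  \<open>s = 0\<close>, both weights become probability densities, and the hypothesis says that the
  laws of \<open>X\<close> and \<open>Y\<close> under them have the same characteristic function.
  For \<open>m = 0\<close> both weights vanish almost everywhere.\<close>

lemma weighted_char_eqD:
  fixes X g :: "'a \<Rightarrow> real" and Y h :: "'b \<Rightarrow> real"
  assumes X [measurable]: "X \<in> borel_measurable M" and Y [measurable]: "Y \<in> borel_measurable N"
    and g: "integrable M g" "\<And>x. g x \<ge> 0" and h: "integrable N h" "\<And>x. h x \<ge> 0"
    and eq: "\<And>s. (LINT x|M. g x *\<^sub>R iexp (s * X x)) = (LINT x|N. h x *\<^sub>R iexp (s * Y x))"
    and A [measurable]: "A \<in> sets borel"
  shows "(LINT x|M. g x * indicator A (X x)) = (LINT x|N. h x * indicator A (Y x))"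
proof -
  define m where "m = (LINT x|M. g x)"
  have gM [measurable]: "g \<in> borel_measurable M" and hM [measurable]: "h \<in> borel_measurable N"
    using g h by auto
  have "complex_of_real m = (LINT x|M. g x *\<^sub>R iexp (0 * X x))"
    by (simp add: m_def scaleR_conv_of_real)
  also have "\<dots> = complex_of_real (LINT x|N. h x)"
    unfolding eq by (simp add: scaleR_conv_of_real)
  finally have m': "m = (LINT x|N. h x)"
    by (simp del: of_real_eq_iff add: of_real_eq_iff [where ?'a = complex, symmetric])
  have "m \<ge> 0" unfolding m_def using g by (intro integral_nonneg_AE) auto
  show ?thesis
  proof (cases "m = 0")
    case True
    then have "AE x in M. g x = 0" "AE x in N. h x = 0"
      using integral_nonneg_eq_0_iff_AE[OF g(1)] integral_nonneg_eq_0_iff_AE[OF h(1)] g h m'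
      by (auto simp: m_def)
    then have "AE x in M. g x * indicator A (X x) = 0" "AE x in N. h x * indicator A (Y x) = 0"
      by auto
    then show ?thesis by (simp add: integral_eq_zero_AE)
  next
    case False
    with \<open>m \<ge> 0\<close> have "m > 0" by simp
    have law: "real_distribution (distr (density K (\<lambda>x. k x / m)) borel Z) \<and>
        (\<forall>s. char (distr (density K (\<lambda>x. k x / m)) borel Z) s = (LINT x|K. k x *\<^sub>R iexp (s * Z x)) / m) \<and>
        measure (distr (density K (\<lambda>x. k x / m)) borel Z) A = (LINT x|K. k x * indicator A (Z x)) / m"
      if Z [measurable]: "Z \<in> borel_measurable K" and k: "integrable K k" "\<And>x. k x \<ge> 0"
        "(LINT x|K. k x) = m" for K :: "'c measure" and k Z
    proof (intro conjI allI)
      have kM [measurable]: "k \<in> borel_measurable K" using k by auto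
      have "prob_space (density K (\<lambda>x. k x / m))"
      proof
        have "emeasure (density K (\<lambda>x. ennreal (k x / m))) (space K) = (\<integral>\<^sup>+ x. ennreal (k x / m) \<partial>K)"
          by (subst emeasure_density) (auto intro!: nn_integral_cong)
        also have "\<dots> = ennreal (LINT x|K. k x / m)"
          using k \<open>m > 0\<close> by (intro nn_integral_eq_integral) auto
        also have "\<dots> = 1" using k \<open>m > 0\<close> by simp
        finally show "emeasure (density K (\<lambda>x. ennreal (k x / m))) (space (density K (\<lambda>x. ennreal (k x / m)))) = 1"
          by simp
      qed
      then interpret D: prob_space "density K (\<lambda>x. k x / m)" .
      show "real_distribution (distr (density K (\<lambda>x. k x / m)) borel Z)"
        by (rule D.real_distribution_distr) simp
      show "char (distr (density K (\<lambda>x. k x / m)) borel Z) s = (LINT x|K. k x *\<^sub>R iexp (s * Z x)) / m" for s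
      proof -
        have "char (distr (density K (\<lambda>x. k x / m)) borel Z) s = (LINT x|K. (k x / m) *\<^sub>R iexp (s * Z x))"
          using k \<open>m > 0\<close> by (simp add: char_def integral_distr integral_density)
        also have "(\<lambda>x. (k x / m) *\<^sub>R iexp (s * Z x)) = (\<lambda>x. (k x *\<^sub>R iexp (s * Z x)) / m)"
          by (auto simp: scaleR_conv_of_real)
        finally show ?thesis by simp
      qed
      have "measure (distr (density K (\<lambda>x. k x / m)) borel Z) A
          = (LINT x|distr (density K (\<lambda>x. k x / m)) borel Z. indicator A x)"
        by simp
      also have "\<dots> = (LINT x|K. k x * indicator A (Z x)) / m"
      proof (subst integral_distr)
        show "(LINT x|density K (\<lambda>x. k x / m). indicator A (Z x)) = (LINT x|K. k x * indicator A (Z x)) / m"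
          using k \<open>m > 0\<close> by (subst integral_density) auto
      qed auto
      finally show "measure (distr (density K (\<lambda>x. k x / m)) borel Z) A = \<dots>" .
    qed
    note lawM = law[OF X g m_def[symmetric]] and lawN = law[OF Y h m'[symmetric]]
    have "distr (density M (\<lambda>x. g x / m)) borel X = distr (density N (\<lambda>x. h x / m)) borel Y"
      by (rule Levy_uniqueness) (use lawM lawN eq in \<open>auto intro!: ext\<close>)
    with lawM lawN \<open>m > 0\<close> show ?thesis by simp
  qed
qed

text \<open>Converts one exponential factor into an indicator while another phase stays in place.
  The extra frequency \<open>r\<close> in the hypothesis makes room for weights that are
  trigonometric polynomials in \<open>Z\<close> and \<open>W\<close>.\<close>

lemma weighted_char_eqD_phase:
  fixes X Z g :: "'a \<Rightarrow> real" and Y W h :: "'b \<Rightarrow> real"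
  assumes X [measurable]: "X \<in> borel_measurable M" and Y [measurable]: "Y \<in> borel_measurable N"
    and Z [measurable]: "Z \<in> borel_measurable M" and W [measurable]: "W \<in> borel_measurable N"
    and g: "integrable M g" "\<And>x. g x \<ge> 0" and h: "integrable N h" "\<And>x. h x \<ge> 0"
    and eq: "\<And>r s. (LINT x|M. g x *\<^sub>R iexp (r * Z x + s * X x)) =
                    (LINT x|N. h x *\<^sub>R iexp (r * W x + s * Y x))"
    and A [measurable]: "A \<in> sets borel"
  shows "(LINT x|M. (g x * indicator A (X x)) *\<^sub>R iexp (Z x)) =
         (LINT x|N. (h x * indicator A (Y x)) *\<^sub>R iexp (W x))"
proof -
  \<comment> \<open>The one-dimensional theorem needs nonnegative weights, which \<open>1 + cos Z\<close> and \<open>1 + sin Z\<close> are.\<close>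
  have gM [measurable]: "g \<in> borel_measurable M" and hM [measurable]: "h \<in> borel_measurable N"
    using g h by auto
  have int: "integrable K (\<lambda>x. k x *\<^sub>R iexp (V x))" "integrable K (\<lambda>x. k x * cos (V x))"
    if "integrable K k" and [measurable]: "V \<in> borel_measurable K" for K :: "'c measure" and k V
    using that(1) by (auto intro!: Bochner_Integration.integrable_bound[OF that(1)] AE_I2 mult_left_le
        simp: abs_mult)
  define c where "c \<theta> = (\<lambda>y. 1 + cos (y - \<theta>))" for \<theta> :: real
  have c0: "c \<theta> y \<ge> 0" for \<theta> y by (simp add: c_def add_nonneg_nonneg) (smt (verit) cos_ge_minus_one)
  \<comment> \<open>By Euler's formula the weight only shifts the frequency of \<open>y\<close> by
    0, 1 or -1, so \<open>eq\<close> is used at \<open>r = 0\<close>, \<open>r = 1\<close> and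
    \<open>r = -1\<close>.\<close>
  have c_exp: "c \<theta> y *\<^sub>R iexp u = iexp (0 * y + u) + (iexp (- \<theta>) / 2) * iexp (1 * y + u) + (iexp \<theta> / 2) * iexp ((- 1) * y + u)"
    for \<theta> y u
  proof -
    have "complex_of_real (cos (y - \<theta>)) = (iexp (y - \<theta>) + iexp (- (y - \<theta>))) / 2"
      by (simp only: cos_of_real[symmetric] cos_exp_eq) (simp add: algebra_simps)
    then have "c \<theta> y *\<^sub>R iexp u = iexp u + iexp (y - \<theta>) * iexp u / 2 + iexp (- (y - \<theta>)) * iexp u / 2"
      by (simp only: c_def scaleR_conv_of_real of_real_add) (simp add: ring_distribs add_divide_distrib)
    moreover have "iexp (y - \<theta>) * iexp u = iexp (- \<theta>) * iexp (1 * y + u)"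
      "iexp (- (y - \<theta>)) * iexp u = iexp \<theta> * iexp ((- 1) * y + u)"
      by (simp_all add: mult_exp_exp algebra_simps)
    ultimately show ?thesis by simp
  qed
  have expand: "(LINT x|K. (k x * c \<theta> (V x)) *\<^sub>R iexp (s * U x)) =
      (LINT x|K. k x *\<^sub>R iexp (0 * V x + s * U x)) + (iexp (- \<theta>) / 2) * (LINT x|K. k x *\<^sub>R iexp (1 * V x + s * U x))
      + (iexp \<theta> / 2) * (LINT x|K. k x *\<^sub>R iexp ((- 1) * V x + s * U x))"
    if k: "integrable K k" and [measurable]: "V \<in> borel_measurable K" "U \<in> borel_measurable K"
    for K :: "'c measure" and k V U \<theta> s
  proof -
    have i: "integrable K (\<lambda>x. k x *\<^sub>R iexp (r * V x + s * U x))" for r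
      using k by (intro int) auto
    have "(LINT x|K. (k x * c \<theta> (V x)) *\<^sub>R iexp (s * U x)) =
       (LINT x|K. k x *\<^sub>R iexp (0 * V x + s * U x) + (iexp (- \<theta>) / 2) * (k x *\<^sub>R iexp (1 * V x + s * U x))
         + (iexp \<theta> / 2) * (k x *\<^sub>R iexp ((- 1) * V x + s * U x)))"
      unfolding scaleR_scaleR [symmetric] c_exp
      by (intro Bochner_Integration.integral_cong refl) (simp add: scaleR_conv_of_real algebra_simps)
    also have "\<dots> = (LINT x|K. k x *\<^sub>R iexp (0 * V x + s * U x)) + (iexp (- \<theta>) / 2) * (LINT x|K. k x *\<^sub>R iexp (1 * V x + s * U x))
      + (iexp \<theta> / 2) * (LINT x|K. k x *\<^sub>R iexp ((- 1) * V x + s * U x))"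
      by (simp only: Bochner_Integration.integral_add Bochner_Integration.integrable_add
          integrable_mult_right integral_mult_right_zero i)
    finally show ?thesis .
  qed
  have intc: "integrable K (\<lambda>x. k x * c \<theta> (V x))"
    if k: "integrable K k" and [measurable]: "V \<in> borel_measurable K" for K :: "'c measure" and k V \<theta>
    unfolding c_def distrib_left using k by (intro Bochner_Integration.integrable_add int) auto
  have *: "(LINT x|M. (g x * c \<theta> (Z x)) * indicator A (X x)) = (LINT x|N. (h x * c \<theta> (W x)) * indicator A (Y x))" for \<theta>
    by (intro weighted_char_eqD X Y A intc g h Z W mult_nonneg_nonneg c0)
       (simp only: expand[OF g(1) Z X] expand[OF h(1) W Y] eq)
  have g1: "(LINT x|M. g x * indicator A (X x)) = (LINT x|N. h x * indicator A (Y x))"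
    using eq[of 0] by (intro weighted_char_eqD X Y A g h) (simp only: mult_zero_left add_0)
  have gi: "integrable M (\<lambda>x. g x * indicator A (X x))"
    using integrable_mult_indicator[of "X -` A \<inter> space M" M g] g
    by (subst Bochner_Integration.integrable_cong[OF refl, of _ _ "\<lambda>x. indicator (X -` A \<inter> space M) x *\<^sub>R g x"])
       (auto simp: indicator_def)
  have hi: "integrable N (\<lambda>x. h x * indicator A (Y x))"
    using integrable_mult_indicator[of "Y -` A \<inter> space N" N h] h
    by (subst Bochner_Integration.integrable_cong[OF refl, of _ _ "\<lambda>x. indicator (Y -` A \<inter> space N) x *\<^sub>R h x"])
       (auto simp: indicator_def)
  have split: "(LINT x|K. (k x * c \<theta> (V x)) * indicator A (U x)) =
      (LINT x|K. k x * indicator A (U x)) + (LINT x|K. (k x * indicator A (U x)) * cos (V x - \<theta>))"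
    if k: "integrable K (\<lambda>x. k x * indicator A (U x))" and [measurable]: "V \<in> borel_measurable K"
    for K :: "'c measure" and k V U \<theta>
    by (subst Bochner_Integration.integral_add[symmetric])
       (use k int(2)[OF k, of "\<lambda>x. V x - \<theta>"] in \<open>auto intro!: Bochner_Integration.integral_cong simp: c_def algebra_simps\<close>)
  have cos_eq: "(LINT x|M. (g x * indicator A (X x)) * cos (Z x - \<theta>)) = (LINT x|N. (h x * indicator A (Y x)) * cos (W x - \<theta>))" for \<theta>
    using *[of \<theta>] g1 by (simp add: split gi hi)
  \<comment> \<open>Two angles suffice: 0 gives the real part, and
    \<open>cos (y - pi / 2) = sin y\<close> gives the imaginary part.\<close>
  have ReIm: "(LINT x|K. k x *\<^sub>R iexp (V x)) = Complex (LINT x|K. k x * cos (V x - 0)) (LINT x|K. k x * cos (V x - pi / 2))"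
    if k: "integrable K k" and [measurable]: "V \<in> borel_measurable K"
    for K :: "'c measure" and k V
  proof (rule complex_eqI)
    show "Re (LINT x|K. k x *\<^sub>R iexp (V x)) = Re (Complex (LINT x|K. k x * cos (V x - 0)) (LINT x|K. k x * cos (V x - pi / 2)))"
      by (subst integral_Re[symmetric]) (use int[OF k, of V] in \<open>auto simp: Re_exp\<close>)
    show "Im (LINT x|K. k x *\<^sub>R iexp (V x)) = Im (Complex (LINT x|K. k x * cos (V x - 0)) (LINT x|K. k x * cos (V x - pi / 2)))"
      by (subst integral_Im[symmetric]) (use int[OF k, of V] in \<open>auto simp: Im_exp cos_diff\<close>)
  qed
  show ?thesis by (simp only: ReIm[OF gi Z] ReIm[OF hi W] cos_eq)
qed

text \<open>Rectangles generate the product sigma-algebra, so it is enough to know the integrals of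
  products of indicators.\<close>

lemma distr_PiM_eqI_char:
  fixes X :: "'i \<Rightarrow> 'a \<Rightarrow> real" and Y :: "'i \<Rightarrow> 'b \<Rightarrow> real"
  assumes M: "prob_space M" and N: "prob_space N" and J: "finite J"
    and X: "\<And>j. j \<in> J \<Longrightarrow> X j \<in> borel_measurable M"
    and Y: "\<And>j. j \<in> J \<Longrightarrow> Y j \<in> borel_measurable N"
    and eq: "\<And>c. (LINT \<omega>|M. iexp (\<Sum>j\<in>J. c j * X j \<omega>)) = (LINT \<omega>|N. iexp (\<Sum>j\<in>J. c j * Y j \<omega>))"
  shows "distr M (\<Pi>\<^sub>M j\<in>J. borel) (\<lambda>\<omega>. \<lambda>j\<in>J. X j \<omega>) = distr N (\<Pi>\<^sub>M j\<in>J. borel) (\<lambda>\<omega>. \<lambda>j\<in>J. Y j \<omega>)"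
proof -
  interpret M: prob_space M by fact
  interpret N: prob_space N by fact
  \<comment> \<open>Exchange the exponential factors for indicator functions, one coordinate at a time.\<close>
  have mixed: "(LINT \<omega>|M. (\<Prod>j\<in>K. indicator (A j) (X j \<omega>)) *\<^sub>R iexp (\<Sum>j\<in>J - K. c j * X j \<omega>)) =
        (LINT \<omega>|N. (\<Prod>j\<in>K. indicator (A j) (Y j \<omega>)) *\<^sub>R iexp (\<Sum>j\<in>J - K. c j * Y j \<omega>))"
    if "finite K" "K \<subseteq> J" "\<And>j. A j \<in> sets borel" for K and A :: "'i \<Rightarrow> real set" and c
    using that
  proof (induction K arbitrary: c)
    case empty
    then show ?case by (simp only: prod.empty scaleR_one Diff_empty eq)
  next
    case (insert k K)
    have k: "k \<in> J" and KJ: "K \<subseteq> J" and Js: "J - K = insert k (J - insert k K)"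
      using insert by auto
    have int: "integrable P (\<lambda>\<omega>. \<Prod>j\<in>K. indicat_real (A j) (U j \<omega>))"
      if "prob_space P" and U: "\<And>j. j \<in> J \<Longrightarrow> U j \<in> borel_measurable P" for P :: "'c measure" and U :: "'i \<Rightarrow> 'c \<Rightarrow> real"
    proof -
      interpret P: prob_space P by fact
      have "(\<lambda>\<omega>. \<Prod>j\<in>K. indicat_real (A j) (U j \<omega>)) \<in> borel_measurable P"
        using KJ U insert.prems by (intro borel_measurable_prod) (auto intro!: measurable_compose[OF U] borel_measurable_indicator)
      moreover have "norm (\<Prod>j\<in>K. indicat_real (A j) (U j \<omega>)) \<le> 1" for \<omega>
        unfolding real_norm_def abs_prod by (intro prod_le_1) (auto simp: indicator_def)
      ultimately show ?thesis by (rule P.integrable_const_bound[OF AE_I2, rotated])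
    qed
    \<comment> \<open>A phase with two frequencies is again a linear combination over
      \<open>J - K\<close>, with other coefficients; hence the induction keeps \<open>c\<close>
      arbitrary.\<close>
    have sums: "(\<Sum>j\<in>J - K. (if j = k then s else r * c j) * U j) =
        r * (\<Sum>j\<in>J - insert k K. c j * U j) + s * U k" for r s and U :: "'i \<Rightarrow> real"
      unfolding Js using J by (subst sum.insert) (auto simp: sum_distrib_left mult.assoc intro!: sum.cong)
    have "(LINT \<omega>|M. ((\<Prod>j\<in>K. indicator (A j) (X j \<omega>)) * indicator (A k) (X k \<omega>)) *\<^sub>R iexp (\<Sum>j\<in>J - insert k K. c j * X j \<omega>)) =
        (LINT \<omega>|N. ((\<Prod>j\<in>K. indicator (A j) (Y j \<omega>)) * indicator (A k) (Y k \<omega>)) *\<^sub>R iexp (\<Sum>j\<in>J - insert k K. c j * Y j \<omega>))"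
    proof (rule weighted_char_eqD_phase)
      show "(LINT \<omega>|M. (\<Prod>j\<in>K. indicator (A j) (X j \<omega>)) *\<^sub>R
          iexp (r * (\<Sum>j\<in>J - insert k K. c j * X j \<omega>) + s * X k \<omega>)) =
          (LINT \<omega>|N. (\<Prod>j\<in>K. indicator (A j) (Y j \<omega>)) *\<^sub>R
          iexp (r * (\<Sum>j\<in>J - insert k K. c j * Y j \<omega>) + s * Y k \<omega>))" for r s
        using insert.IH[OF KJ insert.prems(2), of "\<lambda>j. if j = k then s else r * c j"]
        unfolding sums .
    qed (use k X Y insert.prems in \<open>auto intro!: int M N borel_measurable_sum prod_nonneg simp: M.prob_space_axioms N.prob_space_axioms\<close>)
    then show ?case using insert by (simp add: mult.commute)
  qed
  \<comment> \<open>With \<open>K = J\<close> no exponential is left, and the mixed integral is the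
    probability of a rectangle.\<close>
  have law: "emeasure (distr P (\<Pi>\<^sub>M j\<in>J. borel) (\<lambda>\<omega>. \<lambda>j\<in>J. U j \<omega>)) (Pi\<^sub>E J A) =
      ennreal (Re (LINT \<omega>|P. (\<Prod>j\<in>J. indicator (A j) (U j \<omega>)) *\<^sub>R iexp (\<Sum>j\<in>J - J. 0 * U j \<omega>)))"
    if "prob_space P" and U [measurable]: "\<And>j. j \<in> J \<Longrightarrow> U j \<in> borel_measurable P" and A: "\<And>j. A j \<in> sets borel"
    for P :: "'c measure" and U A
  proof -
    interpret P: prob_space P by fact
    let ?E = "(\<lambda>\<omega>. \<lambda>j\<in>J. U j \<omega>) -` Pi\<^sub>E J A \<inter> space P"
    have m: "(\<lambda>\<omega>. \<lambda>j\<in>J. U j \<omega>) \<in> measurable P (\<Pi>\<^sub>M j\<in>J. borel)"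
      using U by (rule measurable_restrict)
    have PA: "Pi\<^sub>E J A \<in> sets (\<Pi>\<^sub>M j\<in>J. borel)"
      using J A by (intro sets_PiM_I_finite) auto
    have E: "?E \<in> sets P" using m PA by (rule measurable_sets)
    have "(LINT \<omega>|P. (\<Prod>j\<in>J. indicator (A j) (U j \<omega>)) *\<^sub>R iexp (\<Sum>j\<in>J - J. 0 * U j \<omega>)) =
        (LINT \<omega>|P. complex_of_real (indicator ?E \<omega>))"
    proof (intro Bochner_Integration.integral_cong refl)
      fix \<omega> assume "\<omega> \<in> space P"
      then have "(\<Prod>j\<in>J. indicat_real (A j) (U j \<omega>)) = indicator ?E \<omega>"
        using J by (cases "\<forall>j\<in>J. U j \<omega> \<in> A j") (auto simp: indicator_def PiE_iff)
      then show "(\<Prod>j\<in>J. indicat_real (A j) (U j \<omega>)) *\<^sub>R iexp (\<Sum>j\<in>J - J. 0 * U j \<omega>) = complex_of_real (indicator ?E \<omega>)"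
        by (simp add: scaleR_conv_of_real)
    qed
    also have "\<dots> = complex_of_real (measure P ?E)"
      using E by (subst integral_complex_of_real) simp
    finally show ?thesis
      using m PA by (simp add: emeasure_distr P.emeasure_eq_measure)
  qed
  have "prob_space (distr M (\<Pi>\<^sub>M j\<in>J. borel) (\<lambda>\<omega>. \<lambda>j\<in>J. X j \<omega>))"
    using X by (intro M.prob_space_distr measurable_restrict)
  then interpret D: prob_space "distr M (\<Pi>\<^sub>M j\<in>J. borel) (\<lambda>\<omega>. \<lambda>j\<in>J. X j \<omega>)" .
  show ?thesis
  proof (rule measure_eqI_PiM_finite[OF J])
    show "emeasure (distr M (\<Pi>\<^sub>M j\<in>J. borel) (\<lambda>\<omega>. \<lambda>j\<in>J. X j \<omega>)) (Pi\<^sub>E J A) =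
       emeasure (distr N (\<Pi>\<^sub>M j\<in>J. borel) (\<lambda>\<omega>. \<lambda>j\<in>J. Y j \<omega>)) (Pi\<^sub>E J A)" if A: "\<And>j. j \<in> J \<Longrightarrow> A j \<in> sets borel" for A
    proof -
      \<comment> \<open>\<open>mixed\<close> asks for Borel sets at every index, so the values of
        \<open>A\<close> outside \<open>J\<close> are replaced by the empty set.\<close>
      let ?B = "\<lambda>j. if j \<in> J then A j else {}"
      have B: "Pi\<^sub>E J A = Pi\<^sub>E J ?B" "\<And>j. ?B j \<in> sets borel" using A by (auto intro!: PiE_cong)
      show ?thesis
        unfolding B(1)
        by (rule trans[OF law[OF M X B(2)] trans[OF arg_cong[where f = "\<lambda>z. ennreal (Re z)",
              OF mixed[OF J order_refl B(2)]] law[OF N Y B(2), symmetric]]])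
    qed
    show "range (\<lambda>_::nat. \<Pi>\<^sub>E j\<in>J. UNIV) \<subseteq> prod_algebra J (\<lambda>_. borel)"
      using J by (auto intro!: prod_algebraI_finite)
  qed (auto simp: space_PiM D.emeasure_eq_measure)
qed

section \<open>Second moments and \<open>L\<^sup>2\<close> convergence\<close>

lemma quadratic_limit_of_cos:
  "(\<lambda>n. 2 * (1 - cos (x / real (Suc n))) * (real (Suc n))\<^sup>2) \<longlonglongrightarrow> x\<^sup>2" for x :: real
proof (cases "x = 0")
  case False
  have "((\<lambda>y::real. 2 * (1 - cos y) / y\<^sup>2) \<longlongrightarrow> 1) (at 0)" by real_asymp
  moreover have "filterlim (\<lambda>n. x / real (Suc n)) (at 0) sequentially"
    unfolding filterlim_at using False LIMSEQ_Suc[OF lim_const_over_n[of x]] by auto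
  ultimately have "(\<lambda>n. 2 * (1 - cos (x / real (Suc n))) / (x / real (Suc n))\<^sup>2) \<longlonglongrightarrow> 1"
    by (rule filterlim_compose)
  from tendsto_mult[OF this tendsto_const[of "x\<^sup>2"]] show ?thesis
    using False by (simp add: power_divide)
qed simp

text \<open>Fatou's lemma applied to \<open>2 (1 - cos (X / n)) n\<^sup>2 \<longlonglongrightarrow> X\<^sup>2\<close>.\<close>

lemma (in prob_space) second_moment_le_char:
  assumes X [measurable]: "X \<in> borel_measurable M"
    and L: "(\<lambda>n. (1 - Re (expectation (\<lambda>\<omega>. iexp (X \<omega> / real (Suc n))))) * (real (Suc n))\<^sup>2) \<longlonglongrightarrow> L"
  shows "integrable M (\<lambda>\<omega>. (X \<omega>)\<^sup>2)" "expectation (\<lambda>\<omega>. (X \<omega>)\<^sup>2) \<le> 2 * L"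
proof -
  let ?a = "\<lambda>n \<omega>. 2 * (1 - cos (X \<omega> / real (Suc n))) * (real (Suc n))\<^sup>2"
  have int: "integrable M (\<lambda>\<omega>. iexp (X \<omega> / real (Suc n)))" for n
    by (intro integrable_iexp) auto
  have intc: "integrable M (\<lambda>\<omega>. cos (X \<omega> / real (Suc n)))" for n
    using integrable_Re[OF int[of n]] by (simp add: Re_exp)
  have ex: "(\<integral>\<^sup>+\<omega>. ennreal (?a n \<omega>) \<partial>M) =
     ennreal (2 * ((1 - Re (expectation (\<lambda>\<omega>. iexp (X \<omega> / real (Suc n))))) * (real (Suc n))\<^sup>2))" for n
  proof -
    have "Re (expectation (\<lambda>\<omega>. iexp (X \<omega> / real (Suc n)))) = expectation (\<lambda>\<omega>. cos (X \<omega> / real (Suc n)))"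
      using integral_Re[OF int[of n]] by (simp add: Re_exp)
    moreover have "(\<integral>\<^sup>+\<omega>. ennreal (?a n \<omega>) \<partial>M) = ennreal (expectation (?a n))"
      using intc by (intro nn_integral_eq_integral) auto
    moreover have "expectation (?a n) = 2 * (1 - expectation (\<lambda>\<omega>. cos (X \<omega> / real (Suc n)))) * (real (Suc n))\<^sup>2"
      using intc[of n] by (simp add: prob_space)
    ultimately show ?thesis by (simp only: mult.assoc)
  qed
  have "(\<integral>\<^sup>+\<omega>. ennreal ((X \<omega>)\<^sup>2) \<partial>M) = (\<integral>\<^sup>+\<omega>. liminf (\<lambda>n. ennreal (?a n \<omega>)) \<partial>M)"
    by (intro nn_integral_cong lim_imp_Liminf[symmetric] tendsto_ennrealI quadratic_limit_of_cos) auto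
  also have "\<dots> \<le> liminf (\<lambda>n. \<integral>\<^sup>+\<omega>. ennreal (?a n \<omega>) \<partial>M)"
    by (intro nn_integral_liminf) auto
  also have "\<dots> = ennreal (2 * L)"
    unfolding ex by (intro lim_imp_Liminf tendsto_ennrealI tendsto_mult tendsto_const L) auto
  finally have le: "(\<integral>\<^sup>+\<omega>. ennreal ((X \<omega>)\<^sup>2) \<partial>M) \<le> ennreal (2 * L)" .
  \<comment> \<open>\<open>ennreal\<close> sends negative numbers to 0, so \<open>le\<close> could
    not be read back as a bound between reals if \<open>L\<close> were negative.\<close>
  have "L \<ge> 0"
  proof (rule LIMSEQ_le_const[OF L], intro exI allI impI mult_nonneg_nonneg)
    fix n
    have "Re (expectation (\<lambda>\<omega>. iexp (X \<omega> / real (Suc n)))) \<le> expectation (\<lambda>\<omega>. 1)"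
      unfolding integral_Re[OF int[of n], symmetric] using intc[of n]
      by (intro integral_mono) (auto simp: Re_exp)
    then show "1 - Re (expectation (\<lambda>\<omega>. iexp (X \<omega> / real (Suc n)))) \<ge> 0" by (simp add: prob_space)
  qed auto
  show int2: "integrable M (\<lambda>\<omega>. (X \<omega>)\<^sup>2)"
    using le by (intro integrableI_nonneg) (auto simp: le_less_trans)
  show "expectation (\<lambda>\<omega>. (X \<omega>)\<^sup>2) \<le> 2 * L"
    using le \<open>L \<ge> 0\<close> nn_integral_eq_integral[OF int2] by (simp add: ennreal_le_iff)
qed

lemma square_add_le: "(a + b)\<^sup>2 \<le> 2 * a\<^sup>2 + 2 * (b::real)\<^sup>2"
  using zero_le_power2[of "a - b"] by (simp add: power2_eq_square algebra_simps)

lemma L2_lincomb: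
  assumes X: "X \<in> L2 M" and Y: "Y \<in> L2 M"
  shows "(\<lambda>\<omega>. a * X \<omega> + b * Y \<omega>) \<in> L2 M"
proof -
  have [measurable]: "X \<in> borel_measurable M" "Y \<in> borel_measurable M"
    using X Y by (auto simp: L2_def)
  have "integrable M (\<lambda>\<omega>. 2 * (a\<^sup>2 * (X \<omega>)\<^sup>2) + 2 * (b\<^sup>2 * (Y \<omega>)\<^sup>2))"
    using X Y by (auto simp: L2_def)
  then have "integrable M (\<lambda>\<omega>. (a * X \<omega> + b * Y \<omega>)\<^sup>2)"
  proof (rule Bochner_Integration.integrable_bound[OF _ _ AE_I2])
    show "norm ((a * X \<omega> + b * Y \<omega>)\<^sup>2) \<le> norm (2 * (a\<^sup>2 * (X \<omega>)\<^sup>2) + 2 * (b\<^sup>2 * (Y \<omega>)\<^sup>2))" for \<omega>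
      using square_add_le[of "a * X \<omega>" "b * Y \<omega>"] by (simp add: power_mult_distrib)
  qed simp
  then show ?thesis by (simp add: L2_def)
qed

lemma L2_diff: "X \<in> L2 M \<Longrightarrow> Y \<in> L2 M \<Longrightarrow> (\<lambda>\<omega>. X \<omega> - Y \<omega>) \<in> L2 M"
  using L2_lincomb[of X M Y 1 "-1"] by simp

lemma L2_integral_add_le:
  assumes X: "X \<in> L2 M" and Y: "Y \<in> L2 M"
  shows "(LINT \<omega>|M. (X \<omega> + Y \<omega>)\<^sup>2) \<le> 2 * (LINT \<omega>|M. (X \<omega>)\<^sup>2) + 2 * (LINT \<omega>|M. (Y \<omega>)\<^sup>2)"
proof -
  have "(LINT \<omega>|M. (X \<omega> + Y \<omega>)\<^sup>2) \<le> (LINT \<omega>|M. 2 * (X \<omega>)\<^sup>2 + 2 * (Y \<omega>)\<^sup>2)"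
    using X Y L2_lincomb[OF X Y, of 1 1] by (intro integral_mono square_add_le) (auto simp: L2_def)
  also have "\<dots> = 2 * (LINT \<omega>|M. (X \<omega>)\<^sup>2) + 2 * (LINT \<omega>|M. (Y \<omega>)\<^sup>2)"
    using X Y by (simp add: L2_def)
  finally show ?thesis .
qed

lemma L2_tendsto_lincomb:
  assumes X: "L2_tendsto M X Y" and Z: "L2_tendsto M Z W"
  shows "L2_tendsto M (\<lambda>n \<omega>. a * X n \<omega> + b * Z n \<omega>) (\<lambda>\<omega>. a * Y \<omega> + b * W \<omega>)"
  unfolding L2_tendsto_def
proof (intro conjI allI)
  show "(\<lambda>\<omega>. a * X n \<omega> + b * Z n \<omega>) \<in> L2 M" for n
    using X Z by (intro L2_lincomb) (auto simp: L2_tendsto_def)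
  show "(\<lambda>\<omega>. a * Y \<omega> + b * W \<omega>) \<in> L2 M"
    using X Z by (intro L2_lincomb) (auto simp: L2_tendsto_def)
  have 0: "(\<lambda>n. 2 * (a\<^sup>2 * (LINT \<omega>|M. (X n \<omega> - Y \<omega>)\<^sup>2)) + 2 * (b\<^sup>2 * (LINT \<omega>|M. (Z n \<omega> - W \<omega>)\<^sup>2))) \<longlonglongrightarrow> 0"
    using X Z by (auto simp: L2_tendsto_def intro!: tendsto_add_zero tendsto_mult_right_zero)
  show "(\<lambda>n. LINT \<omega>|M. (a * X n \<omega> + b * Z n \<omega> - (a * Y \<omega> + b * W \<omega>))\<^sup>2) \<longlonglongrightarrow> 0"
  proof (rule tendsto_sandwich[OF _ _ tendsto_const 0])
    have "(LINT \<omega>|M. (a * X n \<omega> + b * Z n \<omega> - (a * Y \<omega> + b * W \<omega>))\<^sup>2) \<le>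
        2 * (a\<^sup>2 * (LINT \<omega>|M. (X n \<omega> - Y \<omega>)\<^sup>2)) + 2 * (b\<^sup>2 * (LINT \<omega>|M. (Z n \<omega> - W \<omega>)\<^sup>2))" for n
    proof -
      have XY: "(\<lambda>\<omega>. a * (X n \<omega> - Y \<omega>)) \<in> L2 M" and ZW: "(\<lambda>\<omega>. b * (Z n \<omega> - W \<omega>)) \<in> L2 M"
        using L2_lincomb[of "X n" M Y a "-a"] L2_lincomb[of "Z n" M W b "-b"] X Z
        by (auto simp: L2_tendsto_def algebra_simps)
      have "(\<lambda>\<omega>. a * X n \<omega> + b * Z n \<omega> - (a * Y \<omega> + b * W \<omega>)) = (\<lambda>\<omega>. a * (X n \<omega> - Y \<omega>) + b * (Z n \<omega> - W \<omega>))"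
        by (auto simp: algebra_simps)
      then show ?thesis using L2_integral_add_le[OF XY ZW] by (simp add: power_mult_distrib fun_eq_iff)
    qed
    then show "\<forall>\<^sub>F n in sequentially. (LINT \<omega>|M. (a * X n \<omega> + b * Z n \<omega> - (a * Y \<omega> + b * W \<omega>))\<^sup>2) \<le>
        2 * (a\<^sup>2 * (LINT \<omega>|M. (X n \<omega> - Y \<omega>)\<^sup>2)) + 2 * (b\<^sup>2 * (LINT \<omega>|M. (Z n \<omega> - W \<omega>)\<^sup>2))"
      by (intro always_eventually) auto
  qed auto
qed

text \<open>For real x and y, |e^(ix) - e^(iy)| \<le> |x - y|, and a mean absolute value is at most
  the root of the mean square because a variance is nonnegative.\<close>

lemma L2_tendsto_iexp:
  assumes "prob_space M" and X: "L2_tendsto M X Y"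
  shows "(\<lambda>n. LINT \<omega>|M. iexp (X n \<omega>)) \<longlonglongrightarrow> (LINT \<omega>|M. iexp (Y \<omega>))"
proof -
  interpret prob_space M by fact
  have XM [measurable]: "X n \<in> borel_measurable M" for n
    using X by (auto simp: L2_tendsto_def L2_def)
  have YM [measurable]: "Y \<in> borel_measurable M"
    using X by (auto simp: L2_tendsto_def L2_def)
  have int2: "integrable M (\<lambda>\<omega>. (X n \<omega> - Y \<omega>)\<^sup>2)" for n
    using X L2_diff[of "X n" M Y] by (auto simp: L2_tendsto_def L2_def)
  have int1: "integrable M (\<lambda>\<omega>. X n \<omega> - Y \<omega>)" for n
    by (rule square_integrable_imp_integrable[OF _ int2]) simp
  have bound: "cmod ((LINT \<omega>|M. iexp (X n \<omega>)) - (LINT \<omega>|M. iexp (Y \<omega>))) \<le> sqrt (LINT \<omega>|M. (X n \<omega> - Y \<omega>)\<^sup>2)" for n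
  proof -
    have "(LINT \<omega>|M. iexp (X n \<omega>)) - (LINT \<omega>|M. iexp (Y \<omega>)) = (LINT \<omega>|M. iexp (X n \<omega>) - iexp (Y \<omega>))"
      by (intro Bochner_Integration.integral_diff[symmetric] integrable_iexp) auto
    also have "cmod \<dots> \<le> (LINT \<omega>|M. \<bar>X n \<omega> - Y \<omega>\<bar>)"
    proof (intro order_trans[OF integral_norm_bound] integral_mono)
      show "cmod (iexp (X n \<omega>) - iexp (Y \<omega>)) \<le> \<bar>X n \<omega> - Y \<omega>\<bar>" for \<omega>
      proof -
        have "iexp (X n \<omega>) - iexp (Y \<omega>) = iexp (Y \<omega>) * (iexp (X n \<omega> - Y \<omega>) - 1)"
          by (simp add: algebra_simps mult_exp_exp)
        then show ?thesis
          using iexp_approx1[of "X n \<omega> - Y \<omega>" 0] by (simp add: norm_mult)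
      qed
      show "integrable M (\<lambda>\<omega>. cmod (iexp (X n \<omega>) - iexp (Y \<omega>)))"
        by (intro integrable_norm Bochner_Integration.integrable_diff integrable_iexp) auto
    qed (use int1[of n] in auto)
    also have "\<dots> \<le> sqrt (LINT \<omega>|M. \<bar>X n \<omega> - Y \<omega>\<bar>\<^sup>2)"
    proof (rule real_le_rsqrt)
      show "(LINT \<omega>|M. \<bar>X n \<omega> - Y \<omega>\<bar>)\<^sup>2 \<le> (LINT \<omega>|M. \<bar>X n \<omega> - Y \<omega>\<bar>\<^sup>2)"
        using int1[of n] int2[of n] variance_positive[of "\<lambda>\<omega>. \<bar>X n \<omega> - Y \<omega>\<bar>"]
        by (subst (asm) variance_eq) auto
    qed
    finally show ?thesis by simp
  qed
  have "(\<lambda>n. sqrt (LINT \<omega>|M. (X n \<omega> - Y \<omega>)\<^sup>2)) \<longlonglongrightarrow> 0"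
    using tendsto_real_sqrt[of _ 0] X by (auto simp: L2_tendsto_def)
  then have "(\<lambda>n. (LINT \<omega>|M. iexp (X n \<omega>)) - (LINT \<omega>|M. iexp (Y \<omega>))) \<longlonglongrightarrow> 0"
    by (rule Lim_null_comparison[rotated]) (use bound in auto)
  then show ?thesis by (rule LIM_zero_cancel)
qed

text \<open>Serves to show that the L2 limit does not depend on the approximating sequence.\<close>

lemma L2_tendsto_cong_limit:
  assumes X: "L2_tendsto M X Y" and Z: "\<And>n. Z n \<in> L2 M"
    and d: "(\<lambda>n. LINT \<omega>|M. (Z n \<omega> - X n \<omega>)\<^sup>2) \<longlonglongrightarrow> 0"
  shows "L2_tendsto M Z Y"
  unfolding L2_tendsto_def
proof (intro conjI allI)
  show "Z n \<in> L2 M" for n by fact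
  show Y: "Y \<in> L2 M" using X by (simp add: L2_tendsto_def)
  have 0: "(\<lambda>n. 2 * (LINT \<omega>|M. (Z n \<omega> - X n \<omega>)\<^sup>2) + 2 * (LINT \<omega>|M. (X n \<omega> - Y \<omega>)\<^sup>2)) \<longlonglongrightarrow> 0"
    using X d by (auto simp: L2_tendsto_def intro!: tendsto_add_zero tendsto_mult_right_zero)
  show "(\<lambda>n. LINT \<omega>|M. (Z n \<omega> - Y \<omega>)\<^sup>2) \<longlonglongrightarrow> 0"
  proof (rule tendsto_sandwich[OF _ _ tendsto_const 0])
    have "(LINT \<omega>|M. (Z n \<omega> - Y \<omega>)\<^sup>2) \<le> 2 * (LINT \<omega>|M. (Z n \<omega> - X n \<omega>)\<^sup>2) + 2 * (LINT \<omega>|M. (X n \<omega> - Y \<omega>)\<^sup>2)" for n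
      using L2_integral_add_le[of "\<lambda>\<omega>. Z n \<omega> - X n \<omega>" M "\<lambda>\<omega>. X n \<omega> - Y \<omega>"] X Z Y
      by (auto simp: L2_tendsto_def intro!: L2_diff)
    then show "\<forall>\<^sub>F n in sequentially. (LINT \<omega>|M. (Z n \<omega> - Y \<omega>)\<^sup>2) \<le> 2 * (LINT \<omega>|M. (Z n \<omega> - X n \<omega>)\<^sup>2) + 2 * (LINT \<omega>|M. (X n \<omega> - Y \<omega>)\<^sup>2)"
      by (intro always_eventually) auto
  qed auto
qed

text \<open>For pairings with linear combinations only equality on the space of the measure is
  available: \<open>\<omega>\<close> is known to be linear on \<open>schwartz_dual\<close>, not
  elsewhere.\<close>

lemma L2_tendsto_cong:
  assumes "L2_tendsto M X Y" and eq: "\<And>n \<omega>. \<omega> \<in> space M \<Longrightarrow> X' n \<omega> = X n \<omega>"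
  shows "L2_tendsto M X' Y"
proof -
  have "X' n \<in> borel_measurable M \<longleftrightarrow> X n \<in> borel_measurable M" for n
    by (intro measurable_cong eq)
  moreover have "integrable M (\<lambda>\<omega>. (X' n \<omega>)\<^sup>2) \<longleftrightarrow> integrable M (\<lambda>\<omega>. (X n \<omega>)\<^sup>2)" for n
    by (intro Bochner_Integration.integrable_cong refl) (simp add: eq)
  moreover have "(LINT \<omega>|M. (X' n \<omega> - Y \<omega>)\<^sup>2) = (LINT \<omega>|M. (X n \<omega> - Y \<omega>)\<^sup>2)" for n
    by (intro Bochner_Integration.integral_cong refl) (simp add: eq)
  ultimately show ?thesis using assms(1) by (simp add: L2_tendsto_def L2_def)
qed

text \<open>The Riesz-Fischer argument: along a subsequence with mean-square steps below 4^(-k) the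
  mean absolute steps are at most 2^(-k), so the steps are absolutely summable almost everywhere.
  Fatou's lemma then transfers the Cauchy bounds to the pointwise limit.\<close>

lemma (in prob_space) L2_Cauchy_imp_convergent:
  assumes X: "\<And>n. X n \<in> L2 M"
    and Cauchy: "\<And>e. e > 0 \<Longrightarrow> \<exists>N. \<forall>m\<ge>N. \<forall>n\<ge>N. expectation (\<lambda>\<omega>. (X m \<omega> - X n \<omega>)\<^sup>2) < e"
  obtains Y where "L2_tendsto M X Y"
proof -
  have XM [measurable]: "X n \<in> borel_measurable M" for n using X by (auto simp: L2_def)
  have int2: "integrable M (\<lambda>\<omega>. (X m \<omega> - X n \<omega>)\<^sup>2)" for m n
    using L2_diff[OF X X] by (auto simp: L2_def)
  have "\<exists>N. \<forall>m\<ge>N. \<forall>n\<ge>N. expectation (\<lambda>\<omega>. (X m \<omega> - X n \<omega>)\<^sup>2) < (1/4) ^ k" for k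
    by (rule Cauchy) simp
  then obtain N where N: "\<And>k m n. N k \<le> m \<Longrightarrow> N k \<le> n \<Longrightarrow> expectation (\<lambda>\<omega>. (X m \<omega> - X n \<omega>)\<^sup>2) < (1/4) ^ k"
    by metis
  \<comment> \<open>Summing the thresholds puts \<open>r k\<close> and \<open>r (Suc k)\<close> both
    beyond \<open>N k\<close>; the extra \<open>k\<close> gives \<open>r k \<ge> k\<close>, so that
    bounds for all late indices apply along the subsequence.\<close>
  define r where "r k = (\<Sum>i\<le>k. N i) + k" for k
  have rN: "N k \<le> r k" "N k \<le> r (Suc k)" "k \<le> r k" for k
    using member_le_sum[of k "{..k}" N] by (auto simp: r_def)
  define D where "D k \<omega> = X (r (Suc k)) \<omega> - X (r k) \<omega>" for k \<omega>
  have DM [measurable]: "D k \<in> borel_measurable M" for k by (simp add: D_def[abs_def])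
  have D1: "integrable M (D k)" for k
    unfolding D_def by (rule square_integrable_imp_integrable[OF _ int2]) simp
  have ED: "(\<integral>\<^sup>+\<omega>. ennreal \<bar>D k \<omega>\<bar> \<partial>M) \<le> ennreal ((1/2) ^ k)" for k
  proof -
    have "(expectation (\<lambda>\<omega>. \<bar>D k \<omega>\<bar>))\<^sup>2 \<le> expectation (\<lambda>\<omega>. \<bar>D k \<omega>\<bar>\<^sup>2)"
      using D1[of k, THEN integrable_abs] int2[of "r (Suc k)" "r k"] variance_positive[of "\<lambda>\<omega>. \<bar>D k \<omega>\<bar>"]
      by (subst (asm) variance_eq) (auto simp: D_def[abs_def])
    also have "\<dots> \<le> ((1/2) ^ k)\<^sup>2"
      using N[of k "r (Suc k)" "r k"] rN[of k] by (simp add: D_def power_mult[symmetric] power2_eq_square power_mult_distrib[symmetric])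
    finally have "expectation (\<lambda>\<omega>. \<bar>D k \<omega>\<bar>) \<le> (1/2) ^ k"
      by (rule power2_le_imp_le) simp
    then show ?thesis
      using D1[of k] by (subst nn_integral_eq_integral) (auto intro: ennreal_leI)
  qed
  have "(\<integral>\<^sup>+\<omega>. (\<Sum>k. ennreal \<bar>D k \<omega>\<bar>) \<partial>M) = (\<Sum>k. \<integral>\<^sup>+\<omega>. ennreal \<bar>D k \<omega>\<bar> \<partial>M)"
    by (rule nn_integral_suminf) simp
  also have "\<dots> \<le> (\<Sum>k. ennreal ((1/2) ^ k))"
    by (intro suminf_le ED) auto
  also have "\<dots> < \<infinity>"
    by (subst suminf_ennreal2) (auto intro: summable_geometric)
  finally have "AE \<omega> in M. (\<Sum>k. ennreal \<bar>D k \<omega>\<bar>) \<noteq> \<infinity>"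
    by (intro nn_integral_PInf_AE) auto
  then have conv: "AE \<omega> in M. convergent (\<lambda>k. X (r k) \<omega>)"
  proof eventually_elim
    case (elim \<omega>)
    then have "summable (\<lambda>k. D k \<omega>)"
      using summable_rabs_cancel[OF summable_suminf_not_top[of "\<lambda>k. \<bar>D k \<omega>\<bar>"]] by auto
    then have "convergent (\<lambda>k. X (r 0) \<omega> + (\<Sum>i<k. D i \<omega>))"
      by (intro convergent_add convergent_const) (simp add: summable_iff_convergent)
    moreover have "X (r 0) \<omega> + (\<Sum>i<k. D i \<omega>) = X (r k) \<omega>" for k
      unfolding D_def by (subst sum_lessThan_telescope) simp
    ultimately show ?case by simp
  qed
  define Y where "Y \<omega> = lim (\<lambda>k. X (r k) \<omega>)" for \<omega>
  have YM [measurable]: "Y \<in> borel_measurable M"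
    unfolding Y_def[abs_def] by (rule borel_measurable_lim_metric) simp
  have lim: "AE \<omega> in M. (\<lambda>k. X (r k) \<omega>) \<longlonglongrightarrow> Y \<omega>"
    using conv by eventually_elim (simp add: Y_def convergent_LIMSEQ_iff)
  have Fatou: "(\<integral>\<^sup>+\<omega>. ennreal ((X n \<omega> - Y \<omega>)\<^sup>2) \<partial>M) \<le> ennreal e"
    if M: "\<And>m. M' \<le> m \<Longrightarrow> expectation (\<lambda>\<omega>. (X n \<omega> - X m \<omega>)\<^sup>2) < e" for n e M'
  proof -
    have "(\<integral>\<^sup>+\<omega>. ennreal ((X n \<omega> - Y \<omega>)\<^sup>2) \<partial>M) = (\<integral>\<^sup>+\<omega>. liminf (\<lambda>k. ennreal ((X n \<omega> - X (r k) \<omega>)\<^sup>2)) \<partial>M)"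
      using lim by (intro nn_integral_cong_AE; eventually_elim)
        (auto intro!: lim_imp_Liminf[symmetric] tendsto_ennrealI tendsto_intros)
    also have "\<dots> \<le> liminf (\<lambda>k. \<integral>\<^sup>+\<omega>. ennreal ((X n \<omega> - X (r k) \<omega>)\<^sup>2) \<partial>M)"
      by (rule nn_integral_liminf) simp
    also have "\<dots> \<le> limsup (\<lambda>k. \<integral>\<^sup>+\<omega>. ennreal ((X n \<omega> - X (r k) \<omega>)\<^sup>2) \<partial>M)"
      by (rule Liminf_le_Limsup) simp
    also have "\<dots> \<le> ennreal e"
    proof (rule Limsup_bounded, rule eventually_sequentiallyI)
      fix k assume "M' \<le> k"
      then have "expectation (\<lambda>\<omega>. (X n \<omega> - X (r k) \<omega>)\<^sup>2) < e"
        using rN(3)[of k] by (intro M) auto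
      then show "(\<integral>\<^sup>+\<omega>. ennreal ((X n \<omega> - X (r k) \<omega>)\<^sup>2) \<partial>M) \<le> ennreal e"
        using int2 by (subst nn_integral_eq_integral) (auto intro: ennreal_leI)
    qed
    finally show ?thesis .
  qed
  \<comment> \<open>Any finite bound will do here: it puts \<open>X N1 - Y\<close>, and hence
    \<open>Y\<close>, into \<open>L2\<close>.\<close>
  obtain N1 where N1: "\<And>m n. N1 \<le> m \<Longrightarrow> N1 \<le> n \<Longrightarrow> expectation (\<lambda>\<omega>. (X m \<omega> - X n \<omega>)\<^sup>2) < 1"
    using Cauchy[of 1] by auto
  have "(\<integral>\<^sup>+\<omega>. ennreal ((X N1 \<omega> - Y \<omega>)\<^sup>2) \<partial>M) \<le> ennreal 1"
    by (rule Fatou) (auto intro: N1)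
  then have "(\<lambda>\<omega>. X N1 \<omega> - Y \<omega>) \<in> L2 M"
    unfolding L2_def by (auto intro!: integrableI_nonneg simp: le_less_trans)
  from L2_diff[OF X[of N1] this] have Y: "Y \<in> L2 M" by simp
  have "(\<lambda>n. expectation (\<lambda>\<omega>. (X n \<omega> - Y \<omega>)\<^sup>2)) \<longlonglongrightarrow> 0"
  proof (rule LIMSEQ_I)
    fix e :: real assume "e > 0"
    with Cauchy[of "e/2"] obtain N2 where N2: "\<And>m n. N2 \<le> m \<Longrightarrow> N2 \<le> n \<Longrightarrow> expectation (\<lambda>\<omega>. (X m \<omega> - X n \<omega>)\<^sup>2) < e/2"
      by auto
    have "expectation (\<lambda>\<omega>. (X n \<omega> - Y \<omega>)\<^sup>2) < e" if "n \<ge> N2" for n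
    proof -
      have "ennreal (expectation (\<lambda>\<omega>. (X n \<omega> - Y \<omega>)\<^sup>2)) = (\<integral>\<^sup>+\<omega>. ennreal ((X n \<omega> - Y \<omega>)\<^sup>2) \<partial>M)"
        using L2_diff[OF X[of n] Y] by (subst nn_integral_eq_integral) (auto simp: L2_def)
      also have "\<dots> \<le> ennreal (e/2)"
        by (rule Fatou) (use N2 that in auto)
      finally show ?thesis using \<open>e > 0\<close> by (simp add: ennreal_le_iff)
    qed
    then show "\<exists>no. \<forall>n\<ge>no. norm (expectation (\<lambda>\<omega>. (X n \<omega> - Y \<omega>)\<^sup>2) - 0) < e"
      by (auto intro!: exI[of _ N2])
  qed
  with X Y have "L2_tendsto M X Y" by (simp add: L2_tendsto_def)
  then show ?thesis by (rule that)
qed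

section \<open>The Mittag-Leffler function\<close>

text \<open>Only the interval [R, R + 1] of Euler's integral is kept; there t^(x-1) \<ge> R^(x-1)
  and e^(-t) \<ge> e^(-(R+1)). As R is free, Gamma outgrows every geometric sequence.\<close>

lemma Gamma_lower_bound:
  assumes R: "R > 0" and x: "x \<ge> (1::real)"
  shows "R powr (x - 1) * exp (- (R + 1)) \<le> Gamma x"
proof -
  have 1: "((\<lambda>t. R powr (x - 1) * exp (- (R + 1))) has_integral (R powr (x - 1) * exp (- (R + 1)))) {R..R + 1}"
    using has_integral_const_real[of "R powr (x - 1) * exp (- (R + 1))" R "R + 1"] by simp
  have 2: "((\<lambda>t. t powr (x - 1) / exp t) has_integral Gamma x) {0..}"
    using x by (intro Gamma_integral_real) auto
  define i where "i = integral {R..R + 1} (\<lambda>t. t powr (x - 1) / exp t)"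
  have 3: "((\<lambda>t. t powr (x - 1) / exp t) has_integral i) {R..R + 1}"
    unfolding i_def using R by (intro integrable_integral integrable_continuous_interval continuous_intros) auto
  have "R powr (x - 1) * exp (- (R + 1)) \<le> i"
  proof (rule has_integral_le[OF 1 3])
    fix t assume t: "t \<in> {R..R + 1}"
    then have "R powr (x - 1) * exp (- (R + 1)) \<le> t powr (x - 1) * exp (- t)"
      using R x by (intro mult_mono powr_mono2) auto
    then show "R powr (x - 1) * exp (- (R + 1)) \<le> t powr (x - 1) / exp t"
      by (simp add: exp_minus divide_inverse)
  qed
  also have "i \<le> Gamma x"
    using R by (intro has_integral_subset_le[OF _ 3 2]) auto
  finally show ?thesis .
qed

lemma summable_mittag_leffler:
  assumes \<beta>: "\<beta> > 0"
  shows "summable (\<lambda>n. (1 / Gamma (\<beta> * real n + 1)) * x ^ n)"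
proof -
  \<comment> \<open>This choice makes \<open>R powr \<beta> = 2 * \<bar>x\<bar> + 1\<close>, so the
    n-th term is at most a constant times (|x| / (2|x| + 1))^n \<le> 2^(-n). The summand 1 keeps R
    positive at x = 0.\<close>
  define R where "R = (2 * \<bar>x\<bar> + 1) powr (1 / \<beta>)"
  have R: "R > 0" and R\<beta>: "R powr \<beta> = 2 * \<bar>x\<bar> + 1"
    using \<beta> by (auto simp: R_def powr_powr)
  show ?thesis
  proof (rule summable_comparison_test)
    show "summable (\<lambda>n. exp (R + 1) * (1/2) ^ n)"
      by (intro summable_mult summable_geometric) auto
    have "norm (1 / Gamma (\<beta> * real n + 1) * x ^ n) \<le> exp (R + 1) * (1/2) ^ n" for n
    proof -
      have "R powr (\<beta> * real n) = (2 * \<bar>x\<bar> + 1) ^ n"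
        using R by (simp add: powr_powr[symmetric] R\<beta> powr_realpow)
      then have "(2 * \<bar>x\<bar> + 1) ^ n * exp (- (R + 1)) \<le> Gamma (\<beta> * real n + 1)"
        using Gamma_lower_bound[OF R, of "\<beta> * real n + 1"] \<beta> by simp
      moreover have "0 < (2 * \<bar>x\<bar> + 1) ^ n * exp (- (R + 1))" by (intro mult_pos_pos zero_less_power) auto
      ultimately have "1 / Gamma (\<beta> * real n + 1) \<le> 1 / ((2 * \<bar>x\<bar> + 1) ^ n * exp (- (R + 1)))"
        "Gamma (\<beta> * real n + 1) > 0"
        using \<beta> by (auto intro!: frac_le Gamma_real_pos add_nonneg_pos)
      then have "\<bar>1 / Gamma (\<beta> * real n + 1)\<bar> * \<bar>x\<bar> ^ n \<le> 1 / ((2 * \<bar>x\<bar> + 1) ^ n * exp (- (R + 1))) * \<bar>x\<bar> ^ n"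
        by (intro mult_right_mono) auto
      then have "norm (1 / Gamma (\<beta> * real n + 1) * x ^ n) \<le> 1 / ((2 * \<bar>x\<bar> + 1) ^ n * exp (- (R + 1))) * \<bar>x\<bar> ^ n"
        by (simp only: real_norm_def abs_mult power_abs)
      also have "\<dots> = exp (R + 1) * (\<bar>x\<bar> / (2 * \<bar>x\<bar> + 1)) ^ n"
        unfolding exp_minus power_divide by (simp add: field_simps)
      also have "\<dots> \<le> exp (R + 1) * (1/2) ^ n"
        by (intro mult_left_mono power_mono) (auto simp: field_simps)
      finally show ?thesis .
    qed
    then show "\<exists>N. \<forall>n\<ge>N. norm (1 / Gamma (\<beta> * real n + 1) * x ^ n) \<le> exp (R + 1) * (1/2) ^ n" by blast
  qed
qed

lemma
  assumes \<beta>: "\<beta> > 0"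
  shows isCont_mittag_leffler: "isCont (mittag_leffler \<beta>) x"
    and DERIV_mittag_leffler_0: "(mittag_leffler \<beta> has_real_derivative 1 / Gamma (\<beta> + 1)) (at 0)"
proof -
  let ?c = "\<lambda>n. 1 / Gamma (\<beta> * real n + 1)"
  have ml: "mittag_leffler \<beta> = (\<lambda>x. \<Sum>n. ?c n * x ^ n)"
    by (simp add: mittag_leffler_def fun_eq_iff)
  note D = termdiffs_strong_converges_everywhere[OF summable_mittag_leffler[OF \<beta>], folded ml]
  show "isCont (mittag_leffler \<beta>) x" using D by (rule DERIV_isCont)
  have "(\<Sum>n. diffs ?c n * 0 ^ n) = 1 / Gamma (\<beta> + 1)"
    unfolding powser_zero by (simp add: diffs_def)
  with D[of 0] show "(mittag_leffler \<beta> has_real_derivative 1 / Gamma (\<beta> + 1)) (at 0)" by simp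
qed

lemma mittag_leffler_0: "mittag_leffler \<beta> 0 = 1"
  using powser_zero[of "\<lambda>n. 1 / Gamma (\<beta> * real n + 1)"] by (simp add: mittag_leffler_def)

text \<open>The derivative of E_\<beta> at 0 along the points -r/(n+1)^2, in the form that
  \<open>second_moment_le_char\<close> takes as hypothesis. For r = 0 these points do not avoid 0,
  hence the case distinction.\<close>

lemma mittag_leffler_quadratic_limit:
  assumes \<beta>: "\<beta> > 0"
  shows "(\<lambda>n. (1 - mittag_leffler \<beta> (- (r / (real (Suc n))\<^sup>2))) * (real (Suc n))\<^sup>2) \<longlonglongrightarrow> r / Gamma (\<beta> + 1)"
proof (cases "r = 0")
  case True
  then show ?thesis by (simp add: mittag_leffler_0)
next
  case False
  have "((\<lambda>h. (mittag_leffler \<beta> h - 1) / h) \<longlongrightarrow> 1 / Gamma (\<beta> + 1)) (at 0)"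
    using DERIV_mittag_leffler_0[OF \<beta>] by (simp add: DERIV_def mittag_leffler_0)
  moreover have "filterlim (\<lambda>n. - (r / (real (Suc n))\<^sup>2)) (at 0) sequentially"
    unfolding filterlim_at
  proof
    have "(\<lambda>n. - (r * (1 / real (Suc n)) * (1 / real (Suc n)))) \<longlonglongrightarrow> - (r * 0 * 0)"
      using LIMSEQ_Suc[OF lim_const_over_n[of 1]] by (intro tendsto_intros) auto
    then show "(\<lambda>n. - (r / (real (Suc n))\<^sup>2)) \<longlonglongrightarrow> 0"
      by (simp add: power2_eq_square)
  qed (use False in simp)
  ultimately have "(\<lambda>n. (mittag_leffler \<beta> (- (r / (real (Suc n))\<^sup>2)) - 1) / (- (r / (real (Suc n))\<^sup>2))) \<longlonglongrightarrow> 1 / Gamma (\<beta> + 1)"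
    by (rule filterlim_compose)
  then have "(\<lambda>n. r * ((mittag_leffler \<beta> (- (r / (real (Suc n))\<^sup>2)) - 1) / (- (r / (real (Suc n))\<^sup>2)))) \<longlonglongrightarrow> r * (1 / Gamma (\<beta> + 1))"
    by (intro tendsto_mult tendsto_const)
  moreover have "r * ((m - 1) / (- (r / k))) = (1 - m) * k" for m k :: real
    using False by (simp add: field_simps)
  ultimately show ?thesis by (simp only: mult_1_right times_divide_eq_right)
qed

section \<open>Schwartz functions\<close>

definition rapidly_decreasing :: "(real \<Rightarrow> real) \<Rightarrow> bool" where
  "rapidly_decreasing f \<longleftrightarrow> (\<forall>m. \<exists>K. \<forall>x. \<bar>x\<bar> ^ m * \<bar>f x\<bar> \<le> K)"

text \<open>All closure properties of \<^const>\<open>schwartz\<close> are read off an explicit sequence of derivatives.\<close>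

lemma schwartz_iff:
  "f \<in> schwartz \<longleftrightarrow> (\<exists>D. D 0 = f \<and> (\<forall>n x. (D n has_real_derivative D (Suc n) x) (at x)) \<and>
     (\<forall>n. rapidly_decreasing (D n)))"
proof -
  have bdd: "(\<forall>m. bounded (range (\<lambda>x. x ^ m * g x))) \<longleftrightarrow> rapidly_decreasing g" for g :: "real \<Rightarrow> real"
    by (simp add: rapidly_decreasing_def bounded_iff abs_mult power_abs)
  show ?thesis
  proof
    assume "f \<in> schwartz"
    then have "((deriv ^^ n) f has_real_derivative (deriv ^^ Suc n) f x) (at x)"
      "rapidly_decreasing ((deriv ^^ n) f)" for n x
      by (auto simp: schwartz_def bdd[symmetric] DERIV_deriv_iff_real_differentiable)
    then show "\<exists>D. D 0 = f \<and> (\<forall>n x. (D n has_real_derivative D (Suc n) x) (at x)) \<and> (\<forall>n. rapidly_decreasing (D n))"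
      by (intro exI[of _ "\<lambda>n. (deriv ^^ n) f"]) auto
  next
    assume "\<exists>D. D 0 = f \<and> (\<forall>n x. (D n has_real_derivative D (Suc n) x) (at x)) \<and> (\<forall>n. rapidly_decreasing (D n))"
    then obtain D where D: "D 0 = f" "\<And>n x. (D n has_real_derivative D (Suc n) x) (at x)" "\<And>n. rapidly_decreasing (D n)"
      by blast
    have "(deriv ^^ n) f = D n" for n
      by (induction n) (auto simp: D(1) intro!: DERIV_imp_deriv D(2))
    then show "f \<in> schwartz"
      using D(2,3) bdd[of "D _"] by (auto simp: schwartz_def real_differentiable_def)
  qed
qed

lemma rapidly_decreasing_lincomb:
  assumes "rapidly_decreasing f" "rapidly_decreasing g"
  shows "rapidly_decreasing (\<lambda>x. a * f x + b * g x)"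
  unfolding rapidly_decreasing_def
proof
  fix m
  obtain K L where K: "\<And>x. \<bar>x\<bar> ^ m * \<bar>f x\<bar> \<le> K" and L: "\<And>x. \<bar>x\<bar> ^ m * \<bar>g x\<bar> \<le> L"
    using assms unfolding rapidly_decreasing_def by metis
  have "\<bar>x\<bar> ^ m * \<bar>a * f x + b * g x\<bar> \<le> \<bar>a\<bar> * K + \<bar>b\<bar> * L" for x
  proof -
    have "\<bar>x\<bar> ^ m * \<bar>a * f x + b * g x\<bar> \<le> \<bar>x\<bar> ^ m * (\<bar>a\<bar> * \<bar>f x\<bar> + \<bar>b\<bar> * \<bar>g x\<bar>)"
      by (intro mult_left_mono) (auto simp: abs_mult[symmetric])
    also have "\<dots> = \<bar>a\<bar> * (\<bar>x\<bar> ^ m * \<bar>f x\<bar>) + \<bar>b\<bar> * (\<bar>x\<bar> ^ m * \<bar>g x\<bar>)" by (simp add: algebra_simps)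
    also have "\<dots> \<le> \<bar>a\<bar> * K + \<bar>b\<bar> * L" using K L by (intro add_mono mult_left_mono) auto
    finally show ?thesis .
  qed
  then show "\<exists>K. \<forall>x. \<bar>x\<bar> ^ m * \<bar>a * f x + b * g x\<bar> \<le> K" by blast
qed

text \<open>Since |x| \<le> |z| + t \<le> 2 max(|z|, t), powers of x are controlled by powers of z.
  Translates use z = x - t; differences of an antiderivative use the point z of the mean value
  theorem.\<close>

lemma rapidly_decreasing_nearby:
  assumes f: "rapidly_decreasing f" and t: "t \<ge> 0" and A: "A \<ge> 0"
    and near: "\<And>x. \<exists>z. \<bar>x - z\<bar> \<le> t \<and> \<bar>g x\<bar> \<le> A * \<bar>f z\<bar>"
  shows "rapidly_decreasing g"
  unfolding rapidly_decreasing_def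
proof
  fix m
  obtain K L where K: "\<And>x. \<bar>x\<bar> ^ m * \<bar>f x\<bar> \<le> K" and L: "\<And>x. \<bar>x\<bar> ^ 0 * \<bar>f x\<bar> \<le> L"
    using f unfolding rapidly_decreasing_def by metis
  have "\<bar>x\<bar> ^ m * \<bar>g x\<bar> \<le> A * (2 ^ m * (K + t ^ m * L))" for x
  proof -
    obtain z where z: "\<bar>x - z\<bar> \<le> t" "\<bar>g x\<bar> \<le> A * \<bar>f z\<bar>" using near by blast
    have "\<bar>x\<bar> ^ m \<le> (2 * max \<bar>z\<bar> t) ^ m" using z(1) by (intro power_mono) auto
    also have "\<dots> \<le> 2 ^ m * (\<bar>z\<bar> ^ m + t ^ m)"
      unfolding power_mult_distrib using t by (intro mult_left_mono) (auto simp: max_def)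
    finally have "\<bar>x\<bar> ^ m * \<bar>g x\<bar> \<le> (2 ^ m * (\<bar>z\<bar> ^ m + t ^ m)) * (A * \<bar>f z\<bar>)"
      using z(2) t A by (intro mult_mono) auto
    also have "\<dots> = A * (2 ^ m * (\<bar>z\<bar> ^ m * \<bar>f z\<bar> + t ^ m * \<bar>f z\<bar>))" by (simp add: algebra_simps)
    also have "\<dots> \<le> A * (2 ^ m * (K + t ^ m * L))"
      using K[of z] L[of z] t A by (intro mult_left_mono add_mono) auto
    finally show ?thesis .
  qed
  then show "\<exists>K. \<forall>x. \<bar>x\<bar> ^ m * \<bar>g x\<bar> \<le> K" by blast
qed

lemma schwartz_lincomb:
  assumes "f \<in> schwartz" "g \<in> schwartz"
  shows "(\<lambda>x. a * f x + b * g x) \<in> schwartz"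
proof -
  obtain D E where D: "D 0 = f" "\<And>n x. (D n has_real_derivative D (Suc n) x) (at x)" "\<And>n. rapidly_decreasing (D n)"
    and E: "E 0 = g" "\<And>n x. (E n has_real_derivative E (Suc n) x) (at x)" "\<And>n. rapidly_decreasing (E n)"
    using assms unfolding schwartz_iff by metis
  show ?thesis
    unfolding schwartz_iff
    by (rule exI[of _ "\<lambda>n x. a * D n x + b * E n x"])
      (auto simp: D E intro!: rapidly_decreasing_lincomb derivative_eq_intros D(2) E(2))
qed

lemma schwartz_cmult: "f \<in> schwartz \<Longrightarrow> (\<lambda>x. a * f x) \<in> schwartz"
  using schwartz_lincomb[of f f a 0] by simp

section \<open>Gaussian functions\<close>

lemma rapidly_decreasing_poly_gauss:
  assumes b: "b > 0"
  shows "rapidly_decreasing (\<lambda>x. poly p x * exp (- (b * x\<^sup>2)))"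
proof -
  \<comment> \<open>The exponential series, through its term of index m, handles x^(2m); the power
    |x|^m follows from y \<le> 1 + y^2 with y = |x|^m.\<close>
  have mono: "\<exists>K. \<forall>x. \<bar>x\<bar> ^ m * exp (- (b * x\<^sup>2)) \<le> K" for m
  proof (intro exI allI)
    fix x :: real
    have "(b * x\<^sup>2) ^ m \<le> fact m * exp (b * x\<^sup>2)"
    proof -
      have "(\<Sum>n\<in>{m}. (b * x\<^sup>2) ^ n /\<^sub>R fact n) \<le> (\<Sum>n. (b * x\<^sup>2) ^ n /\<^sub>R fact n)"
        using b exp_converges[of "b * x\<^sup>2"] by (intro sum_le_suminf) (auto simp: sums_iff)
      also have "\<dots> = exp (b * x\<^sup>2)" using exp_converges[of "b * x\<^sup>2"] by (simp add: sums_iff)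
      finally have "(b * x\<^sup>2) ^ m /\<^sub>R fact m \<le> exp (b * x\<^sup>2)" by simp
      then show ?thesis by (simp add: field_simps)
    qed
    then have "x ^ (2 * m) * exp (- (b * x\<^sup>2)) \<le> fact m / b ^ m"
      unfolding power_mult power_mult_distrib using b by (simp add: exp_minus field_simps)
    moreover have "\<bar>x\<bar> ^ m \<le> 1 + x ^ (2 * m)"
    proof -
      have "\<bar>x\<bar> ^ m \<le> 1 + (\<bar>x\<bar> ^ m)\<^sup>2"
        using zero_le_power2[of "\<bar>x\<bar> ^ m - 1"] zero_le_power[of "\<bar>x\<bar>" m]
        unfolding power2_diff mult_1_right one_power2 by linarith
      then show ?thesis by (simp add: power_even_abs power_mult[symmetric] mult.commute)
    qed
    then have "\<bar>x\<bar> ^ m * exp (- (b * x\<^sup>2)) \<le> (1 + x ^ (2 * m)) * exp (- (b * x\<^sup>2))"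
      by (intro mult_right_mono) auto
    moreover have "exp (- (b * x\<^sup>2)) \<le> 1" using b by simp
    ultimately show "\<bar>x\<bar> ^ m * exp (- (b * x\<^sup>2)) \<le> 1 + fact m / b ^ m"
      unfolding distrib_right mult_1_left by linarith
  qed
  \<comment> \<open>Splitting off the constant coefficient leaves a factor x, which raises the
    power; so \<open>m\<close> stays arbitrary in the induction.\<close>
  have "\<exists>K. \<forall>x. \<bar>x\<bar> ^ m * \<bar>poly p x\<bar> * exp (- (b * x\<^sup>2)) \<le> K" for m
  proof (induction p arbitrary: m)
    case (pCons a p)
    obtain K L where K: "\<And>x. \<bar>x\<bar> ^ Suc m * \<bar>poly p x\<bar> * exp (- (b * x\<^sup>2)) \<le> K" and L: "\<And>x. \<bar>x\<bar> ^ m * exp (- (b * x\<^sup>2)) \<le> L"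
      using pCons.IH mono by metis
    have "\<bar>x\<bar> ^ m * \<bar>poly (pCons a p) x\<bar> * exp (- (b * x\<^sup>2)) \<le> \<bar>a\<bar> * L + K" for x
    proof -
      have "\<bar>x\<bar> ^ m * \<bar>poly (pCons a p) x\<bar> * exp (- (b * x\<^sup>2)) \<le> \<bar>x\<bar> ^ m * (\<bar>a\<bar> + \<bar>x\<bar> * \<bar>poly p x\<bar>) * exp (- (b * x\<^sup>2))"
        by (intro mult_left_mono mult_right_mono) (auto simp: abs_mult[symmetric])
      also have "\<dots> = \<bar>a\<bar> * (\<bar>x\<bar> ^ m * exp (- (b * x\<^sup>2))) + \<bar>x\<bar> ^ Suc m * \<bar>poly p x\<bar> * exp (- (b * x\<^sup>2))"
        by (simp add: algebra_simps)
      also have "\<dots> \<le> \<bar>a\<bar> * L + K" using K L by (intro add_mono mult_left_mono) auto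
      finally show ?thesis .
    qed
    then show ?case by blast
  qed auto
  then show ?thesis by (simp add: rapidly_decreasing_def abs_mult mult.assoc)
qed

lemma schwartz_gauss:
  assumes b: "b > 0"
  shows "(\<lambda>x. exp (- (b * x\<^sup>2))) \<in> schwartz"
proof -
  \<comment> \<open>\<open>p n\<close> is the polynomial in front of the Gaussian in its n-th
    derivative, by the product rule; up to sign and scaling these are the Hermite
    polynomials.\<close>
  define p where "p = rec_nat (1 :: real poly) (\<lambda>_ q. pderiv q - [:0, 2 * b:] * q)"
  have "((\<lambda>x. poly (p n) x * exp (- (b * x\<^sup>2))) has_real_derivative poly (p (Suc n)) x * exp (- (b * x\<^sup>2))) (at x)" for n x
    by (auto intro!: derivative_eq_intros poly_DERIV simp: p_def algebra_simps)
  moreover have "(\<lambda>x. poly (p 0) x * exp (- (b * x\<^sup>2))) = (\<lambda>x. exp (- (b * x\<^sup>2)))"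
    by (simp add: p_def)
  ultimately show ?thesis
    unfolding schwartz_iff
    by (intro exI[of _ "\<lambda>n x. poly (p n) x * exp (- (b * x\<^sup>2))"]) (auto intro: rapidly_decreasing_poly_gauss b)
qed

lemma schwartz_normal_density:
  assumes "\<sigma> > 0"
  shows "normal_density 0 \<sigma> \<in> schwartz"
proof -
  have *: "normal_density 0 \<sigma> = (\<lambda>x. 1 / sqrt (2 * pi * \<sigma>\<^sup>2) * exp (- (1 / (2 * \<sigma>\<^sup>2) * x\<^sup>2)))"
    by (simp add: normal_density_def fun_eq_iff)
  show ?thesis unfolding * using assms by (intro schwartz_cmult schwartz_gauss) simp
qed

section \<open>Translates and antiderivatives\<close>

lemma schwartz_shift:
  assumes "f \<in> schwartz"
  shows "(\<lambda>x. f (x - t)) \<in> schwartz"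
proof -
  obtain D where D: "D 0 = f" "\<And>n x. (D n has_real_derivative D (Suc n) x) (at x)" "\<And>n. rapidly_decreasing (D n)"
    using assms unfolding schwartz_iff by metis
  have "((\<lambda>x. D n (x - t)) has_real_derivative D (Suc n) (x - t)) (at x)" for n x
    using DERIV_shift[of "D n" "D (Suc n) (x - t)" x "- t"] D(2) by simp
  moreover have "rapidly_decreasing (\<lambda>x. D n (x - t))" for n
    by (rule rapidly_decreasing_nearby[OF D(3)[of n], of "\<bar>t\<bar>" 1]) (auto intro!: exI[of _ "_ - t"])
  ultimately show ?thesis
    unfolding schwartz_iff using D(1) by (intro exI[of _ "\<lambda>n x. D n (x - t)"]) auto
qed

lemma schwartzI_DERIV:
  assumes f: "rapidly_decreasing f" and g: "g \<in> schwartz"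
    and fg: "\<And>x. (f has_real_derivative g x) (at x)"
  shows "f \<in> schwartz"
proof -
  obtain D where D: "D 0 = g" "\<And>n x. (D n has_real_derivative D (Suc n) x) (at x)" "\<And>n. rapidly_decreasing (D n)"
    using g unfolding schwartz_iff by metis
  have "((case n of 0 \<Rightarrow> f | Suc n \<Rightarrow> D n) has_real_derivative D n x) (at x)"
    "rapidly_decreasing (case n of 0 \<Rightarrow> f | Suc n \<Rightarrow> D n)" for n x
    using f fg D by (auto split: nat.split)
  then show ?thesis
    unfolding schwartz_iff by (intro exI[of _ "\<lambda>n. case n of 0 \<Rightarrow> f | Suc n \<Rightarrow> D n"]) auto
qed

text \<open>An antiderivative need not decay, but its difference over a step t is t times a value of
  g within distance t, by the mean value theorem. The difference is the convolution of g with the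
  indicator of [0, t), which is how mollified indicators arise.\<close>

lemma schwartz_antiderivative_diff:
  assumes g: "g \<in> schwartz" and G: "\<And>x. (G has_real_derivative g x) (at x)" and t: "t \<ge> 0"
  shows "(\<lambda>x. G x - G (x - t)) \<in> schwartz"
proof (rule schwartzI_DERIV)
  show "(\<lambda>x. 1 * g x + (- 1) * g (x - t)) \<in> schwartz"
    by (intro schwartz_lincomb schwartz_shift g)
  show "((\<lambda>x. G x - G (x - t)) has_real_derivative 1 * g x + (- 1) * g (x - t)) (at x)" for x
    using DERIV_diff[OF G[of x], of "\<lambda>x. G (x - t)" "g (x - t)"] DERIV_shift[of G "g (x - t)" x "- t"] G
    by simp
  have "rapidly_decreasing g" using g unfolding schwartz_iff by metis
  then show "rapidly_decreasing (\<lambda>x. G x - G (x - t))"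
  proof (rule rapidly_decreasing_nearby[OF _ t t])
    fix x
    show "\<exists>z. \<bar>x - z\<bar> \<le> t \<and> \<bar>G x - G (x - t)\<bar> \<le> t * \<bar>g z\<bar>"
    proof (cases "t = 0")
      case False
      with t have "x - t < x" by simp
      from MVT2[OF this, of G g] G obtain z where "x - t < z" "z < x" "G x - G (x - t) = t * g z"
        by auto
      then show ?thesis using t by (intro exI[of _ z]) (auto simp: abs_mult)
    qed auto
  qed
qed

lemma schwartz_DERIV:
  assumes "f \<in> schwartz"
  obtains f' where "f' \<in> schwartz" "\<And>x. (f has_real_derivative f' x) (at x)"
proof -
  obtain D where D: "D 0 = f" "\<And>n x. (D n has_real_derivative D (Suc n) x) (at x)" "\<And>n. rapidly_decreasing (D n)"
    using assms unfolding schwartz_iff by metis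
  have "D 1 \<in> schwartz" unfolding schwartz_iff
    by (rule exI[of _ "\<lambda>n. D (Suc n)"]) (use D in auto)
  then show ?thesis using D(1) D(2)[of 0] by (intro that[of "D 1"]) auto
qed

section \<open>Continuity, decay and integrability\<close>

lemma schwartz_continuous: "f \<in> schwartz \<Longrightarrow> isCont f x"
  by (meson schwartz_DERIV DERIV_isCont)

lemma schwartz_borel_measurable: "f \<in> schwartz \<Longrightarrow> f \<in> borel_measurable borel"
  by (intro borel_measurable_continuous_onI continuous_at_imp_continuous_on ballI schwartz_continuous)

lemma schwartz_decay:
  assumes "f \<in> schwartz"
  obtains K where "\<And>x. \<bar>f x\<bar> \<le> K / (1 + x\<^sup>2)"
proof -
  have "rapidly_decreasing f" using assms unfolding schwartz_iff by metis
  then obtain K L where "\<And>x. \<bar>x\<bar> ^ 0 * \<bar>f x\<bar> \<le> K" "\<And>x. \<bar>x\<bar> ^ 2 * \<bar>f x\<bar> \<le> L"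
    unfolding rapidly_decreasing_def by metis
  then have "(1 + x\<^sup>2) * \<bar>f x\<bar> \<le> K + L" for x by (simp add: distrib_right add_mono)
  then have "\<bar>f x\<bar> \<le> (K + L) / (1 + x\<^sup>2)" for x
    by (simp add: pos_le_divide_eq add_pos_nonneg mult.commute)
  then show ?thesis by (rule that)
qed

lemma schwartz_tendsto_0:
  assumes "f \<in> schwartz"
  shows "(f \<longlongrightarrow> 0) at_top" "(f \<longlongrightarrow> 0) at_bot"
proof -
  obtain K where K: "\<And>x. \<bar>f x\<bar> \<le> K / (1 + x\<^sup>2)" using schwartz_decay[OF assms] by blast
  have "((\<lambda>x::real. K / (1 + x\<^sup>2)) \<longlongrightarrow> 0) at_top" "((\<lambda>x::real. K / (1 + x\<^sup>2)) \<longlongrightarrow> 0) at_bot"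
    by real_asymp+
  with K show "(f \<longlongrightarrow> 0) at_top" "(f \<longlongrightarrow> 0) at_bot"
    by - (rule Lim_null_comparison[OF always_eventually]; simp)+
qed

lemma schwartz_integrable:
  assumes "f \<in> schwartz"
  shows "integrable lborel f"
proof -
  obtain K where K: "\<And>x. \<bar>f x\<bar> \<le> K / (1 + x\<^sup>2)" using schwartz_decay[OF assms] by blast
  have "integrable lborel (\<lambda>x::real. K * inverse (1 + x\<^sup>2))"
    using integrable_inverse_1_plus_square by (intro integrable_mult_right) (simp add: set_integrable_def)
  then show ?thesis
    by (rule Bochner_Integration.integrable_bound)
      (use K schwartz_borel_measurable[OF assms] in \<open>auto intro!: AE_I2 order_trans[OF K] simp: divide_inverse\<close>)
qed

section \<open>The Fourier transform\<close>

lemma has_vector_derivative_iexp_mult: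
  "((\<lambda>y. iexp (x * y)) has_vector_derivative (\<i> * of_real x) * iexp (x * y)) (at y within S)"
proof -
  have "((\<lambda>z. exp (\<i> * (of_real x * z))) has_field_derivative (\<i> * of_real x) * iexp (x * y)) (at (of_real y))"
    by (auto intro!: derivative_eq_intros)
  from has_vector_derivative_real_field[OF this] show ?thesis by simp
qed

lemma integrable_iexp_mult:
  fixes f :: "real \<Rightarrow> real"
  assumes f: "integrable lborel f"
  shows "integrable lborel (\<lambda>y. iexp (x * y) * complex_of_real (f y))"
proof -
  have [measurable]: "f \<in> borel_measurable borel" using f by auto
  show ?thesis
    by (rule Bochner_Integration.integrable_bound[OF f]) (auto simp: norm_mult)
qed

lemma fourier_borel_measurable:
  assumes [measurable]: "f \<in> borel_measurable borel"
  shows "fourier f \<in> borel_measurable borel"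
  unfolding fourier_def[abs_def] by measurable

lemma cmod_fourier_le: "cmod (fourier f x) \<le> (LINT y|lborel. \<bar>f y\<bar>) / sqrt (2 * pi)"
proof -
  have "cmod (LINT y|lborel. iexp (x * y) * complex_of_real (f y)) \<le> (LINT y|lborel. \<bar>f y\<bar>)"
    using integral_norm_bound[of lborel "\<lambda>y. iexp (x * y) * complex_of_real (f y)"] by (simp add: norm_mult)
  then show ?thesis
    by (simp add: fourier_def norm_mult norm_divide divide_right_mono)
qed

lemma fourier_lincomb:
  assumes "integrable lborel f" "integrable lborel g"
  shows "fourier (\<lambda>y. a * f y + b * g y) x = of_real a * fourier f x + of_real b * fourier g x"
proof -
  have "(LINT y|lborel. iexp (x * y) * complex_of_real (a * f y + b * g y)) =
      (LINT y|lborel. of_real a * (iexp (x * y) * complex_of_real (f y)) + of_real b * (iexp (x * y) * complex_of_real (g y)))"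
    by (intro Bochner_Integration.integral_cong refl) (simp add: algebra_simps)
  also have "\<dots> = of_real a * (LINT y|lborel. iexp (x * y) * complex_of_real (f y)) +
      of_real b * (LINT y|lborel. iexp (x * y) * complex_of_real (g y))"
    using assms by (simp only: Bochner_Integration.integral_add integral_mult_right_zero integrable_mult_right integrable_iexp_mult)
  finally show ?thesis by (simp add: fourier_def algebra_simps)
qed

lemma fourier_schwartz_lincomb:
  assumes "f \<in> schwartz" "g \<in> schwartz"
  shows "fourier (\<lambda>y. a * f y + b * g y) = (\<lambda>x. of_real a * fourier f x + of_real b * fourier g x)"
  using fourier_lincomb[OF assms[THEN schwartz_integrable]] by (rule ext)

lemma fourier_shift: "fourier (\<lambda>y. f (y - t)) x = iexp (x * t) * fourier f x"
proof -
  have "(LINT y|lborel. iexp (x * y) * complex_of_real (f (y - t))) =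
      (LINT y|lborel. iexp (x * (t + y)) * complex_of_real (f y))"
    using lborel_integral_real_affine[of 1 "\<lambda>y. iexp (x * y) * complex_of_real (f (y - t))" t] by simp
  also have "\<dots> = (LINT y|lborel. iexp (x * t) * (iexp (x * y) * complex_of_real (f y)))"
    by (intro Bochner_Integration.integral_cong refl) (simp add: exp_add algebra_simps)
  finally show ?thesis by (simp add: fourier_def)
qed

lemma fourier_scale:
  assumes "a > 0"
  shows "fourier (\<lambda>y. f (y / a)) x = of_real a * fourier f (a * x)"
proof -
  have "(LINT y|lborel. iexp (x * y) * complex_of_real (f (y / a))) =
      of_real a * (LINT y|lborel. iexp (a * x * y) * complex_of_real (f y))"
    using lborel_integral_real_affine[of a "\<lambda>y. iexp (x * y) * complex_of_real (f (y / a))" 0] assms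
    by (simp add: scaleR_conv_of_real mult.assoc mult.left_commute)
  then show ?thesis by (simp add: fourier_def)
qed

text \<open>Integration by parts: the derivative of e^(ixy) f(y) in y integrates to 0 over the line
  because f vanishes at both ends. The minus sign comes from the positive exponent in the
  kernel.\<close>

lemma fourier_derivative:
  assumes f: "f \<in> schwartz" and f': "f' \<in> schwartz" and D: "\<And>y. (f has_real_derivative f' y) (at y)"
  shows "fourier f' x = - (\<i> * of_real x) * fourier f x"
proof -
  let ?F = "\<lambda>y. iexp (x * y) * complex_of_real (f y)"
  let ?F' = "\<lambda>y. (\<i> * of_real x) * (iexp (x * y) * complex_of_real (f y)) + iexp (x * y) * complex_of_real (f' y)"
  have int: "integrable lborel (\<lambda>y. iexp (x * y) * complex_of_real (f y))" "integrable lborel (\<lambda>y. iexp (x * y) * complex_of_real (f' y))"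
    by (intro integrable_iexp_mult schwartz_integrable f f')+
  have norm_F: "norm (?F y) \<le> \<bar>f y\<bar>" for y by (simp add: norm_mult)
  have "(LBINT y=-\<infinity>..\<infinity>. ?F' y) = 0 - 0"
  proof (rule interval_integral_FTC_integrable[where F = ?F])
    fix y
    note 1 = has_vector_derivative_iexp_mult[of x y UNIV]
    have "((\<lambda>y. complex_of_real (f y)) has_vector_derivative complex_of_real (f' y)) (at y)"
      using D[of y] by (intro has_vector_derivative_of_real) (simp add: has_real_derivative_iff_has_vector_derivative)
    from has_vector_derivative_mult[OF 1 this]
    show "(?F has_vector_derivative ?F' y) (at y)"
      by (simp add: algebra_simps)
    show "isCont ?F' y"
      using schwartz_continuous[OF f, of y] schwartz_continuous[OF f', of y] by (auto intro!: continuous_intros)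
  next
    show "set_integrable lborel (einterval (- \<infinity>) \<infinity>) ?F'"
      using int by (simp add: set_integrable_def)
    show "((?F \<circ> real_of_ereal) \<longlongrightarrow> 0) (at_right (- \<infinity>))"
      unfolding ereal_tendsto_simps
      using tendsto_rabs_zero[OF schwartz_tendsto_0(2)[OF f]]
      by (rule Lim_null_comparison[rotated]) (intro always_eventually allI norm_F)
    show "((?F \<circ> real_of_ereal) \<longlongrightarrow> 0) (at_left \<infinity>)"
      unfolding ereal_tendsto_simps
      using tendsto_rabs_zero[OF schwartz_tendsto_0(1)[OF f]]
      by (rule Lim_null_comparison[rotated]) (intro always_eventually allI norm_F)
  qed simp
  moreover have "(LBINT y=-\<infinity>..\<infinity>. ?F' y) = (LINT y|lborel. ?F' y)"
    by (simp add: interval_lebesgue_integral_def set_lebesgue_integral_def)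
  ultimately have "(\<i> * of_real x) * (LINT y|lborel. ?F y) + (LINT y|lborel. iexp (x * y) * complex_of_real (f' y)) = 0"
    using int by simp
  then have "(LINT y|lborel. iexp (x * y) * complex_of_real (f' y)) = - (\<i> * of_real x) * (LINT y|lborel. ?F y)"
    by (simp add: add_eq_0_iff)
  then show ?thesis by (simp add: fourier_def)
qed

text \<open>Keeping the factor ix on the left avoids a division at x = 0.\<close>

lemma fourier_indicator:
  assumes "t \<ge> 0"
  shows "\<i> * of_real x * fourier (indicat_real {0..<t}) x = (iexp (x * t) - 1) / sqrt (2 * pi)"
proof -
  have "(LINT y|lborel. \<i> * of_real x * (iexp (x * y) * complex_of_real (indicat_real {0..<t} y))) =
     (LINT y|lborel. indicator {0..t} y *\<^sub>R (\<i> * of_real x * iexp (x * y)))"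
  proof (rule integral_cong_AE)
    have "AE y in lborel. y \<noteq> t" by (rule AE_lborel_singleton)
    then show "AE y in lborel. \<i> * of_real x * (iexp (x * y) * complex_of_real (indicat_real {0..<t} y)) = indicator {0..t} y *\<^sub>R (\<i> * of_real x * iexp (x * y))"
      by eventually_elim (auto simp: indicator_def)
  qed measurable
  also have "\<dots> = iexp (x * t) - iexp (x * 0)"
  proof (rule integral_FTC_Icc[OF assms])
    show "((\<lambda>y. iexp (x * y)) has_vector_derivative (\<i> * of_real x) * iexp (x * y)) (at y within {0..t})" for y
      by (rule has_vector_derivative_iexp_mult)
  qed (auto intro!: continuous_intros)
  finally show ?thesis
    by (simp add: fourier_def field_simps)
qed

lemma integrable_indicator_interval: "integrable lborel (indicat_real {a..<b::real})"
  by (cases "a \<le> b") (simp_all add: integrable_indicator_iff)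

section \<open>The weighted norm\<close>

text \<open>Near 0 the exponent 1 - \<alpha> exceeds -1 because \<alpha> < 2; at infinity the
  exponent is -1 - \<alpha> < -1 because \<alpha> > 0. Multiples of this function dominate the
  squared transforms against the weight.\<close>

lemma integrable_powr_cutoff:
  fixes \<alpha> :: real
  assumes "0 < \<alpha>" "\<alpha> < 2"
  shows "integrable lborel (\<lambda>x. (if \<bar>x\<bar> \<le> 1 then 1 else 1 / x\<^sup>2) * \<bar>x\<bar> powr (1 - \<alpha>))"
proof -
  let ?h = "\<lambda>x. (if \<bar>x\<bar> \<le> 1 then 1 else 1 / x\<^sup>2) * \<bar>x\<bar> powr (1 - \<alpha>)"
  \<comment> \<open>A nonnegative gauge integrable function is Lebesgue integrable; Borel
    measurability then allows \<open>lborel\<close> in place of its completion.\<close>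
  have lborel: "set_integrable lborel A f" if "f integrable_on A" "\<And>x. x \<in> A \<Longrightarrow> 0 \<le> f x"
    "A \<in> sets borel" "f \<in> borel_measurable borel" for A and f :: "real \<Rightarrow> real"
  proof -
    have "f absolutely_integrable_on A"
      by (rule nonnegative_absolutely_integrable_1) (use that in auto)
    then show ?thesis
      using that(3,4) unfolding set_integrable_def by (subst (asm) integrable_completion) auto
  qed
  have 1: "set_integrable lborel {0..1} (\<lambda>x. x powr (1 - \<alpha>))"
    using has_integral_powr_from_0[of "1 - \<alpha>" 1] assms by (intro lborel) (auto simp: integrable_on_def)
  have 2: "set_integrable lborel {1..} (\<lambda>x. x powr (- 1 - \<alpha>))"
    using has_integral_powr_to_inf[of "- 1 - \<alpha>" 1] assms by (intro lborel) (auto simp: integrable_on_def)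
  have pos: "integrable lborel (\<lambda>x. indicator {0..} x * ?h x)"
  proof (rule Bochner_Integration.integrable_bound)
    show "integrable lborel (\<lambda>x. indicator {0..1} x * x powr (1 - \<alpha>) + indicator {1..} x * x powr (- 1 - \<alpha>))"
      using 1 2 by (intro Bochner_Integration.integrable_add) (simp_all add: set_integrable_def)
    have "1 / x\<^sup>2 * x powr (1 - \<alpha>) = x powr (- 1 - \<alpha>)" if "x > 1" for x :: real
    proof -
      have "1 / x\<^sup>2 = x powr (- 2)" using that by (simp add: powr_minus powr_numeral inverse_eq_divide)
      then show ?thesis by (simp add: powr_add[symmetric])
    qed
    then show "AE x in lborel. norm (indicator {0..} x * ?h x) \<le> norm (indicator {0..1} x * x powr (1 - \<alpha>) + indicator {1..} x * x powr (- 1 - \<alpha>))"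
      by (intro AE_I2) (auto simp: indicator_def)
  qed simp
  from lborel_integrable_real_affine[OF this, of "-1" 0]
  have "integrable lborel (\<lambda>x. indicator {..0} x * ?h x)"
    by (simp add: indicator_def cong: if_cong)
  from Bochner_Integration.integrable_add[OF pos this] show ?thesis
    by (rule Bochner_Integration.integrable_bound) (auto intro!: AE_I2 simp: indicator_def)
qed

text \<open>The square of the weighted norm without the constant C(\<alpha>), as a plain real
  integral: the symmetries of the norm become substitutions, with no square root in the way.\<close>

definition weighted_sq :: "real \<Rightarrow> (real \<Rightarrow> complex) \<Rightarrow> real" where
  "weighted_sq \<alpha> u = (LINT x|lborel. (cmod (u x))\<^sup>2 * \<bar>x\<bar> powr (1 - \<alpha>))"

lemma weighted_sq_nonneg: "weighted_sq \<alpha> u \<ge> 0"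
  by (simp add: weighted_sq_def integral_nonneg_AE)

lemma weighted_norm_eq: "weighted_norm \<alpha> u = sqrt (C_alpha \<alpha> * weighted_sq \<alpha> u)"
proof -
  have "weighted_inner \<alpha> u u = complex_of_real (C_alpha \<alpha>) *
      (LINT x|lborel. complex_of_real ((cmod (u x))\<^sup>2 * \<bar>x\<bar> powr (1 - \<alpha>)))"
    unfolding weighted_inner_def
    by (intro arg_cong2[where f = "(*)"] refl Bochner_Integration.integral_cong)
       (simp add: complex_norm_square mult.commute flip: of_real_power)
  then show ?thesis
    by (simp only: weighted_norm_def weighted_sq_def integral_complex_of_real of_real_mult[symmetric] Re_complex_of_real)
qed

lemma C_alpha_pos:
  assumes "0 < \<alpha>" "\<alpha> < 2"
  shows "C_alpha \<alpha> > 0"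
  unfolding C_alpha_def using assms by (intro mult_pos_pos Gamma_real_pos sin_gt_zero) auto

lemma weighted_norm_tendsto_0_iff:
  assumes "0 < \<alpha>" "\<alpha> < 2"
  shows "((\<lambda>n. weighted_norm \<alpha> (u n)) \<longlonglongrightarrow> 0) \<longleftrightarrow> ((\<lambda>n. weighted_sq \<alpha> (u n)) \<longlonglongrightarrow> 0)"
proof
  assume "(\<lambda>n. weighted_norm \<alpha> (u n)) \<longlonglongrightarrow> 0"
  then have "(\<lambda>n. (weighted_norm \<alpha> (u n))\<^sup>2 / C_alpha \<alpha>) \<longlonglongrightarrow> 0\<^sup>2 / C_alpha \<alpha>"
    using C_alpha_pos[OF assms] by (intro tendsto_intros) auto
  moreover have "(weighted_norm \<alpha> (u n))\<^sup>2 / C_alpha \<alpha> = weighted_sq \<alpha> (u n)" for n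
    using C_alpha_pos[OF assms] weighted_sq_nonneg[of \<alpha> "u n"] by (simp add: weighted_norm_eq)
  ultimately show "(\<lambda>n. weighted_sq \<alpha> (u n)) \<longlonglongrightarrow> 0" by simp
next
  assume "(\<lambda>n. weighted_sq \<alpha> (u n)) \<longlonglongrightarrow> 0"
  then have "(\<lambda>n. sqrt (C_alpha \<alpha> * weighted_sq \<alpha> (u n))) \<longlonglongrightarrow> sqrt (C_alpha \<alpha> * 0)"
    by (intro tendsto_intros)
  then show "(\<lambda>n. weighted_norm \<alpha> (u n)) \<longlonglongrightarrow> 0" by (simp add: weighted_norm_eq)
qed

text \<open>The two bounds together say |u|^2 \<le> A^2 min(1, 1/x^2), which is the cutoff of
  \<open>integrable_powr_cutoff\<close>. For Schwartz functions the second bound is the first one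
  for the derivative; for indicators it comes from |e^(ixt) - 1| \<le> 2.\<close>

lemma weighted_L2I:
  assumes \<alpha>: "0 < \<alpha>" "\<alpha> < 2"
    and [measurable]: "u \<in> borel_measurable borel"
    and A: "\<And>x. cmod (u x) \<le> A" "\<And>x. \<bar>x\<bar> * cmod (u x) \<le> A"
  shows "u \<in> weighted_L2 \<alpha>"
proof -
  have "integrable lborel (\<lambda>x. (cmod (u x))\<^sup>2 * \<bar>x\<bar> powr (1 - \<alpha>))"
  proof (rule Bochner_Integration.integrable_bound[OF integrable_mult_right[OF integrable_powr_cutoff[OF \<alpha>]]])
    show "AE x in lborel. norm ((cmod (u x))\<^sup>2 * \<bar>x\<bar> powr (1 - \<alpha>)) \<le>
        norm (A\<^sup>2 * ((if \<bar>x\<bar> \<le> 1 then 1 else 1 / x\<^sup>2) * \<bar>x\<bar> powr (1 - \<alpha>)))"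
    proof (intro AE_I2)
      fix x :: real
      have 1: "(cmod (u x))\<^sup>2 \<le> A\<^sup>2" using A(1)[of x] by (intro power_mono) auto
      have "(\<bar>x\<bar> * cmod (u x))\<^sup>2 \<le> A\<^sup>2" using A(2)[of x] by (intro power_mono) auto
      then have "(cmod (u x))\<^sup>2 \<le> A\<^sup>2 * (1 / x\<^sup>2)" if "x \<noteq> 0"
        using that by (simp add: power_mult_distrib field_simps)
      with 1 have "(cmod (u x))\<^sup>2 \<le> A\<^sup>2 * (if \<bar>x\<bar> \<le> 1 then 1 else 1 / x\<^sup>2)" by auto
      then have "(cmod (u x))\<^sup>2 * \<bar>x\<bar> powr (1 - \<alpha>) \<le> A\<^sup>2 * (if \<bar>x\<bar> \<le> 1 then 1 else 1 / x\<^sup>2) * \<bar>x\<bar> powr (1 - \<alpha>)"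
        by (intro mult_right_mono) auto
      then show "norm ((cmod (u x))\<^sup>2 * \<bar>x\<bar> powr (1 - \<alpha>)) \<le>
        norm (A\<^sup>2 * ((if \<bar>x\<bar> \<le> 1 then 1 else 1 / x\<^sup>2) * \<bar>x\<bar> powr (1 - \<alpha>)))"
        by (auto simp: mult.assoc)
    qed
  qed measurable
  then show ?thesis by (simp add: weighted_L2_def)
qed

lemma fourier_schwartz_weighted_L2:
  assumes \<alpha>: "0 < \<alpha>" "\<alpha> < 2" and f: "f \<in> schwartz"
  shows "fourier f \<in> weighted_L2 \<alpha>"
proof -
  obtain f' where f': "f' \<in> schwartz" "\<And>x. (f has_real_derivative f' x) (at x)"
    using schwartz_DERIV[OF f] by blast
  have "\<bar>x\<bar> * cmod (fourier f x) = cmod (fourier f' x)" for x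
    using fourier_derivative[OF f f'] by (simp add: norm_mult)
  then show ?thesis
    using cmod_fourier_le[of f] cmod_fourier_le[of f'] schwartz_borel_measurable[OF f]
    by (intro weighted_L2I[OF \<alpha>, where A = "max ((LINT y|lborel. \<bar>f y\<bar>) / sqrt (2 * pi)) ((LINT y|lborel. \<bar>f' y\<bar>) / sqrt (2 * pi))"]
        fourier_borel_measurable) (auto simp: le_max_iff_disj)
qed

lemma fourier_indicator_weighted_L2:
  assumes \<alpha>: "0 < \<alpha>" "\<alpha> < 2" and t: "t \<ge> 0"
  shows "fourier (indicat_real {0..<t}) \<in> weighted_L2 \<alpha>"
proof (rule weighted_L2I[OF \<alpha> fourier_borel_measurable])
  fix x
  have "\<bar>x\<bar> * cmod (fourier (indicat_real {0..<t}) x) = cmod (iexp (x * t) - 1) / sqrt (2 * pi)"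
    using arg_cong[OF fourier_indicator[OF t, of x], of cmod] by (simp add: norm_mult norm_divide)
  also have "\<dots> \<le> 2 / sqrt (2 * pi)"
    using norm_triangle_ineq4[of "iexp (x * t)" 1] by (intro divide_right_mono) auto
  finally show "\<bar>x\<bar> * cmod (fourier (indicat_real {0..<t}) x) \<le> max (2 / sqrt (2 * pi)) ((LINT y|lborel. \<bar>indicat_real {0..<t} y\<bar>) / sqrt (2 * pi))"
    by simp
  show "cmod (fourier (indicat_real {0..<t}) x) \<le> max (2 / sqrt (2 * pi)) ((LINT y|lborel. \<bar>indicat_real {0..<t} y\<bar>) / sqrt (2 * pi))"
    using cmod_fourier_le[of "indicat_real {0..<t}" x] by simp
qed simp

lemma cmod_add_square_le: "(cmod (a + b))\<^sup>2 \<le> 2 * (cmod a)\<^sup>2 + 2 * (cmod b)\<^sup>2"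
proof -
  have "(cmod (a + b))\<^sup>2 \<le> (cmod a + cmod b)\<^sup>2" by (intro power_mono norm_triangle_ineq) auto
  also have "\<dots> \<le> 2 * (cmod a)\<^sup>2 + 2 * (cmod b)\<^sup>2"
    using zero_le_power2[of "cmod a - cmod b"] by (simp add: power2_eq_square algebra_simps)
  finally show ?thesis .
qed

lemma weighted_sq_cmult: "weighted_sq \<alpha> (\<lambda>x. c * u x) = (cmod c)\<^sup>2 * weighted_sq \<alpha> u"
  by (simp add: weighted_sq_def norm_mult power_mult_distrib mult.assoc)

text \<open>The substitution y = ax contributes a^2 from the amplitude, a^(-1) from the differential
  and a^(\<alpha> - 1) from the weight, altogether a^\<alpha>.\<close>

lemma weighted_sq_dilation:
  assumes "a > 0"
  shows "weighted_sq \<alpha> (\<lambda>x. of_real a * u (a * x)) = a powr \<alpha> * weighted_sq \<alpha> u"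
proof -
  have "weighted_sq \<alpha> u = a * (LINT x|lborel. a powr (1 - \<alpha>) * ((cmod (u (a * x)))\<^sup>2 * \<bar>x\<bar> powr (1 - \<alpha>)))"
    unfolding weighted_sq_def
    using lborel_integral_real_affine[of a "\<lambda>x. (cmod (u x))\<^sup>2 * \<bar>x\<bar> powr (1 - \<alpha>)" 0] assms
    by (simp add: abs_mult powr_mult mult_ac)
  also have "\<dots> = a * a powr (1 - \<alpha>) * weighted_sq \<alpha> (\<lambda>x. u (a * x))"
    by (simp add: weighted_sq_def)
  finally have "a powr \<alpha> * weighted_sq \<alpha> u = (a * (a powr \<alpha> * a powr (1 - \<alpha>))) * weighted_sq \<alpha> (\<lambda>x. u (a * x))"
    by (simp add: mult_ac)
  also have "a powr \<alpha> * a powr (1 - \<alpha>) = a"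
    using assms by (simp add: powr_add[symmetric])
  finally show ?thesis
    by (simp add: weighted_sq_cmult power2_eq_square)
qed

lemma weighted_L2_cmult: "u \<in> weighted_L2 \<alpha> \<Longrightarrow> (\<lambda>x. c * u x) \<in> weighted_L2 \<alpha>"
  by (auto simp: weighted_L2_def norm_mult power_mult_distrib mult.assoc)

lemma
  assumes u: "u \<in> weighted_L2 \<alpha>" and v: "v \<in> weighted_L2 \<alpha>"
  shows weighted_L2_add: "(\<lambda>x. u x + v x) \<in> weighted_L2 \<alpha>"
    and weighted_sq_add_le: "weighted_sq \<alpha> (\<lambda>x. u x + v x) \<le> 2 * weighted_sq \<alpha> u + 2 * weighted_sq \<alpha> v"
proof -
  let ?w = "\<lambda>x::real. \<bar>x\<bar> powr (1 - \<alpha>)"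
  have [measurable]: "u \<in> borel_measurable borel" "v \<in> borel_measurable borel"
    and int: "integrable lborel (\<lambda>x. (cmod (u x))\<^sup>2 * ?w x)" "integrable lborel (\<lambda>x. (cmod (v x))\<^sup>2 * ?w x)"
    using u v by (auto simp: weighted_L2_def)
  have int2: "integrable lborel (\<lambda>x. 2 * ((cmod (u x))\<^sup>2 * ?w x) + 2 * ((cmod (v x))\<^sup>2 * ?w x))"
    using int by auto
  have le: "(cmod (u x + v x))\<^sup>2 * ?w x \<le> 2 * ((cmod (u x))\<^sup>2 * ?w x) + 2 * ((cmod (v x))\<^sup>2 * ?w x)" for x
    using mult_right_mono[OF cmod_add_square_le[of "u x" "v x"], of "?w x"] by (simp add: distrib_right mult.assoc)
  have int3: "integrable lborel (\<lambda>x. (cmod (u x + v x))\<^sup>2 * ?w x)"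
    by (rule Bochner_Integration.integrable_bound[OF int2]) (auto intro!: AE_I2 order_trans[OF le])
  then show "(\<lambda>x. u x + v x) \<in> weighted_L2 \<alpha>" by (simp add: weighted_L2_def)
  have "weighted_sq \<alpha> (\<lambda>x. u x + v x) \<le> (LINT x|lborel. 2 * ((cmod (u x))\<^sup>2 * ?w x) + 2 * ((cmod (v x))\<^sup>2 * ?w x))"
    unfolding weighted_sq_def by (intro integral_mono int2 int3 le)
  also have "\<dots> = 2 * weighted_sq \<alpha> u + 2 * weighted_sq \<alpha> v"
    unfolding weighted_sq_def using int by simp
  finally show "weighted_sq \<alpha> (\<lambda>x. u x + v x) \<le> 2 * weighted_sq \<alpha> u + 2 * weighted_sq \<alpha> v" .
qed

lemma weighted_L2_diff:
  "u \<in> weighted_L2 \<alpha> \<Longrightarrow> v \<in> weighted_L2 \<alpha> \<Longrightarrow> (\<lambda>x. u x - v x) \<in> weighted_L2 \<alpha>"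
  using weighted_L2_add[of u \<alpha> "\<lambda>x. - 1 * v x"] weighted_L2_cmult[of v \<alpha> "- 1"] by simp

text \<open>With d = |a - b|, the mixed term 2 d |b| is split into d^2/\<delta> + \<delta> |b|^2.
  The small coefficient of |b|^2 makes the estimate usable under the integral, without a triangle
  inequality for the weighted norm.\<close>

lemma abs_diff_squares_le:
  fixes a b :: complex
  assumes "\<delta> > 0"
  shows "\<bar>(cmod a)\<^sup>2 - (cmod b)\<^sup>2\<bar> \<le> (1 + 1 / \<delta>) * (cmod (a - b))\<^sup>2 + \<delta> * (cmod b)\<^sup>2"
proof -
  let ?d = "cmod (a - b)"
  have "\<bar>cmod a - cmod b\<bar> \<le> ?d" by (rule norm_triangle_ineq3)
  have "\<bar>(cmod a)\<^sup>2 - (cmod b)\<^sup>2\<bar> = \<bar>cmod a - cmod b\<bar> * (cmod a + cmod b)"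
    by (simp add: power2_eq_square square_diff_square_factored abs_mult mult.commute)
  also have "\<dots> \<le> ?d * (?d + 2 * cmod b)"
    using \<open>\<bar>cmod a - cmod b\<bar> \<le> ?d\<close> by (intro mult_mono) auto
  also have "\<dots> = ?d\<^sup>2 + 2 * ?d * cmod b" by (simp add: power2_eq_square algebra_simps)
  also have "2 * ?d * cmod b \<le> ?d\<^sup>2 / \<delta> + \<delta> * (cmod b)\<^sup>2"
    using zero_le_power2[of "?d - \<delta> * cmod b"] assms by (simp add: power2_eq_square field_simps)
  finally show ?thesis by (simp add: algebra_simps)
qed

lemma weighted_sq_tendsto:
  assumes u: "\<And>n. u n \<in> weighted_L2 \<alpha>" and v: "v \<in> weighted_L2 \<alpha>"
    and lim: "(\<lambda>n. weighted_sq \<alpha> (\<lambda>x. u n x - v x)) \<longlonglongrightarrow> 0"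
  shows "(\<lambda>n. weighted_sq \<alpha> (u n)) \<longlonglongrightarrow> weighted_sq \<alpha> v"
proof (rule LIMSEQ_I)
  fix e :: real assume "e > 0"
  let ?w = "\<lambda>x::real. \<bar>x\<bar> powr (1 - \<alpha>)"
  \<comment> \<open>Chosen so that \<open>\<delta> * weighted_sq \<alpha> v\<close> stays at most
    e/2; the added 1 avoids a division by zero.\<close>
  define \<delta> where "\<delta> = e / (2 * (weighted_sq \<alpha> v + 1))"
  have sv: "weighted_sq \<alpha> v \<ge> 0" by (rule weighted_sq_nonneg)
  then have \<delta>: "\<delta> > 0" using \<open>e > 0\<close> by (simp add: \<delta>_def)
  have \<delta>2: "\<delta> * weighted_sq \<alpha> v \<le> e / 2"
    using sv \<open>e > 0\<close> by (simp add: \<delta>_def field_simps)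
  have bound: "\<bar>weighted_sq \<alpha> (u n) - weighted_sq \<alpha> v\<bar> \<le>
      (1 + 1 / \<delta>) * weighted_sq \<alpha> (\<lambda>x. u n x - v x) + \<delta> * weighted_sq \<alpha> v" for n
  proof -
    have int: "integrable lborel (\<lambda>x. (cmod (u n x))\<^sup>2 * ?w x)" "integrable lborel (\<lambda>x. (cmod (v x))\<^sup>2 * ?w x)"
      "integrable lborel (\<lambda>x. (cmod (u n x - v x))\<^sup>2 * ?w x)"
      using u v weighted_L2_diff[OF u v] by (auto simp: weighted_L2_def)
    have diff: "weighted_sq \<alpha> (u n) - weighted_sq \<alpha> v = (LINT x|lborel. (cmod (u n x))\<^sup>2 * ?w x - (cmod (v x))\<^sup>2 * ?w x)"
      using int by (simp add: weighted_sq_def)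
    have "\<bar>LINT x|lborel. (cmod (u n x))\<^sup>2 * ?w x - (cmod (v x))\<^sup>2 * ?w x\<bar> \<le> (LINT x|lborel. (1 + 1 / \<delta>) * ((cmod (u n x - v x))\<^sup>2 * ?w x) + \<delta> * ((cmod (v x))\<^sup>2 * ?w x))"
    proof (rule integral_abs_bound_integral)
      fix x
      have "\<bar>(cmod (u n x))\<^sup>2 * ?w x - (cmod (v x))\<^sup>2 * ?w x\<bar> = \<bar>(cmod (u n x))\<^sup>2 - (cmod (v x))\<^sup>2\<bar> * ?w x"
        by (simp add: left_diff_distrib[symmetric] abs_mult)
      also have "\<dots> \<le> ((1 + 1 / \<delta>) * (cmod (u n x - v x))\<^sup>2 + \<delta> * (cmod (v x))\<^sup>2) * ?w x"
        by (intro mult_right_mono abs_diff_squares_le \<delta>) simp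
      finally show "\<bar>(cmod (u n x))\<^sup>2 * ?w x - (cmod (v x))\<^sup>2 * ?w x\<bar> \<le> (1 + 1 / \<delta>) * ((cmod (u n x - v x))\<^sup>2 * ?w x) + \<delta> * ((cmod (v x))\<^sup>2 * ?w x)"
        by (simp add: distrib_right mult.assoc)
    qed (intro Bochner_Integration.integrable_add Bochner_Integration.integrable_diff integrable_mult_right int)+
    also have "\<dots> = (1 + 1 / \<delta>) * weighted_sq \<alpha> (\<lambda>x. u n x - v x) + \<delta> * weighted_sq \<alpha> v"
      unfolding weighted_sq_def
      by (simp only: Bochner_Integration.integral_add integral_mult_right_zero integrable_mult_right int)
    finally show ?thesis unfolding diff .
  qed
  have "(\<lambda>n. (1 + 1 / \<delta>) * weighted_sq \<alpha> (\<lambda>x. u n x - v x)) \<longlonglongrightarrow> 0"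
    using lim by (rule tendsto_mult_right_zero)
  from LIMSEQ_D[OF this, of "e / 2"] \<open>e > 0\<close>
  obtain N where N: "\<And>n. n \<ge> N \<Longrightarrow> \<bar>(1 + 1 / \<delta>) * weighted_sq \<alpha> (\<lambda>x. u n x - v x)\<bar> < e / 2"
    unfolding diff_0_right real_norm_def using half_gt_zero by blast
  have "norm (weighted_sq \<alpha> (u n) - weighted_sq \<alpha> v) < e" if "n \<ge> N" for n
    using bound[of n] \<delta>2 N[OF that] unfolding real_norm_def by linarith
  then show "\<exists>N. \<forall>n\<ge>N. norm (weighted_sq \<alpha> (u n) - weighted_sq \<alpha> v) < e" by blast
qed

section \<open>Approximation of indicator functions by Schwartz functions\<close>

lemma fourier_normal_density:
  assumes \<sigma>: "\<sigma> > 0"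
  shows "fourier (normal_density 0 \<sigma>) x = of_real (exp (- (\<sigma> * x)\<^sup>2 / 2) / sqrt (2 * pi))"
proof -
  have scale: "normal_density 0 \<sigma> (\<sigma> * y) = std_normal_density y / \<sigma>" for y
    using \<sigma> by (simp add: normal_density_def real_sqrt_mult power_mult_distrib)
  have "(LINT y|lborel. iexp (x * y) * complex_of_real (normal_density 0 \<sigma> y)) =
      of_real \<sigma> * (LINT y|lborel. iexp (x * (\<sigma> * y)) * complex_of_real (normal_density 0 \<sigma> (\<sigma> * y)))"
    using lborel_integral_real_affine[of \<sigma> "\<lambda>y. iexp (x * y) * complex_of_real (normal_density 0 \<sigma> y)" 0] \<sigma>
    by (simp add: scaleR_conv_of_real)
  also have "\<dots> = (LINT y|lborel. of_real \<sigma> * (iexp (x * (\<sigma> * y)) * complex_of_real (normal_density 0 \<sigma> (\<sigma> * y))))"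
    by simp
  also have "\<dots> = (LINT y|lborel. std_normal_density y *\<^sub>R iexp (\<sigma> * x * y))"
    using \<sigma> by (intro Bochner_Integration.integral_cong refl) (simp add: scale scaleR_conv_of_real, simp add: mult_ac)
  also have "\<dots> = char std_normal_distribution (\<sigma> * x)"
    by (simp add: char_def integral_density)
  also have "\<dots> = of_real (exp (- (\<sigma> * x)\<^sup>2 / 2))"
    by (simp add: char_std_normal_distribution)
  finally show ?thesis by (simp add: fourier_def)
qed

text \<open>The witness is the convolution of a Gaussian density g with the indicator. Its
  derivative is g(x) - g(x - t), with transform 1 - e^(ixt) times that of g; comparison with
  \<open>fourier_indicator\<close> cancels the factors sqrt(2 pi). The identity first appears
  multiplied by x, hence the exclusion of 0.\<close>

lemma mollified_indicator:
  assumes \<sigma>: "\<sigma> > 0" and t: "t \<ge> 0"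
  obtains \<xi> where "\<xi> \<in> schwartz"
    "\<And>x. x \<noteq> 0 \<Longrightarrow> fourier \<xi> x = of_real (exp (- (\<sigma> * x)\<^sup>2 / 2)) * fourier (indicat_real {0..<t}) x"
proof -
  let ?g = "normal_density 0 \<sigma>"
  have g: "?g \<in> schwartz" by (rule schwartz_normal_density[OF \<sigma>])
  obtain G where G: "\<And>x. (G has_real_derivative ?g x) (at x)"
    using einterval_antiderivative[of "- \<infinity>" \<infinity> ?g] schwartz_continuous[OF g]
    by (auto simp: has_real_derivative_iff_has_vector_derivative)
  define \<xi> where "\<xi> x = G x - G (x - t)" for x
  have \<xi>: "\<xi> \<in> schwartz" unfolding \<xi>_def[abs_def] by (rule schwartz_antiderivative_diff[OF g G t])
  have D: "(\<xi> has_real_derivative 1 * ?g x + (- 1) * ?g (x - t)) (at x)" for x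
    using DERIV_diff[OF G[of x], of "\<lambda>x. G (x - t)" "?g (x - t)"] DERIV_shift[of G "?g (x - t)" x "- t"] G
    by (simp add: \<xi>_def[abs_def])
  have "- (\<i> * of_real x) * fourier \<xi> x = fourier (\<lambda>x. 1 * ?g x + (- 1) * ?g (x - t)) x" for x
    by (rule fourier_derivative[symmetric, OF \<xi> _ D]) (intro schwartz_lincomb schwartz_shift g)
  also have "fourier (\<lambda>x. 1 * ?g x + (- 1) * ?g (x - t)) x = (1 - iexp (x * t)) * fourier ?g x" for x
    using schwartz_integrable[OF g] schwartz_integrable[OF schwartz_shift[OF g]]
    by (subst fourier_lincomb) (auto simp: fourier_shift algebra_simps)
  also have "(1 - iexp (x * t)) * fourier ?g x =
      - (\<i> * of_real x) * (of_real (exp (- (\<sigma> * x)\<^sup>2 / 2)) * fourier (indicat_real {0..<t}) x)" for x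
  proof -
    have "1 - iexp (x * t) = - of_real (sqrt (2 * pi)) * (\<i> * of_real x * fourier (indicat_real {0..<t}) x)"
      unfolding fourier_indicator[OF t] by simp
    then show ?thesis unfolding fourier_normal_density[OF \<sigma>] by simp
  qed
  finally have eq: "- (\<i> * of_real x) * fourier \<xi> x =
      - (\<i> * of_real x) * (of_real (exp (- (\<sigma> * x)\<^sup>2 / 2)) * fourier (indicat_real {0..<t}) x)" for x .
  have "fourier \<xi> x = of_real (exp (- (\<sigma> * x)\<^sup>2 / 2)) * fourier (indicat_real {0..<t}) x" if "x \<noteq> 0" for x
    using eq[of x] by (rule mult_left_cancel[THEN iffD1, rotated]) (use that in simp)
  with \<xi> show ?thesis by (rule that)
qed

text \<open>The modulus of the error is k_n times that of the transform itself, where 0 \<le> k_n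
  \<le> 1 and k_n tends to 0 pointwise for variances 1/(n+1)^2, so dominated convergence applies.
  The point 0, which \<open>mollified_indicator\<close> omits, is a null set.\<close>

lemma fourier_indicator_in_schwartz_completion:
  assumes \<alpha>: "0 < \<alpha>" "\<alpha> < 2" and t: "t \<ge> 0"
  shows "fourier (indicat_real {0..<t}) \<in> schwartz_completion \<alpha>"
proof -
  let ?u = "fourier (indicat_real {0..<t})"
  let ?w = "\<lambda>x::real. \<bar>x\<bar> powr (1 - \<alpha>)"
  have u: "?u \<in> weighted_L2 \<alpha>" by (rule fourier_indicator_weighted_L2[OF \<alpha> t])
  then have [measurable]: "?u \<in> borel_measurable borel" and int: "integrable lborel (\<lambda>x. (cmod (?u x))\<^sup>2 * ?w x)"
    by (auto simp: weighted_L2_def)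
  have "\<exists>\<xi>. \<xi> \<in> schwartz \<and> (\<forall>x. x \<noteq> 0 \<longrightarrow> fourier \<xi> x = of_real (exp (- (1 / real (Suc n) * x)\<^sup>2 / 2)) * ?u x)" for n
    using mollified_indicator[of "1 / real (Suc n)" t] t by (metis of_nat_0_less_iff zero_less_Suc zero_less_divide_1_iff)
  then obtain \<xi> where \<xi>: "\<And>n. \<xi> n \<in> schwartz"
    and F: "\<And>n x. x \<noteq> 0 \<Longrightarrow> fourier (\<xi> n) x = of_real (exp (- (1 / real (Suc n) * x)\<^sup>2 / 2)) * ?u x"
    by metis
  have [measurable]: "fourier (\<xi> n) \<in> borel_measurable borel" for n
    by (intro fourier_borel_measurable schwartz_borel_measurable \<xi>)
  define k where "k n x = 1 - exp (- (1 / real (Suc n) * x)\<^sup>2 / 2)" for n x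
  have k: "0 \<le> k n x" "k n x \<le> 1" for n x by (auto simp: k_def)
  have "(\<lambda>n. weighted_sq \<alpha> (\<lambda>x. fourier (\<xi> n) x - ?u x)) \<longlonglongrightarrow> 0"
  proof -
    have eq: "weighted_sq \<alpha> (\<lambda>x. fourier (\<xi> n) x - ?u x) = (LINT x|lborel. (k n x)\<^sup>2 * ((cmod (?u x))\<^sup>2 * ?w x))" for n
      unfolding weighted_sq_def
    proof (rule integral_cong_AE)
      have "AE x::real in lborel. x \<noteq> 0" by (rule AE_lborel_singleton)
      then show "AE x in lborel. (cmod (fourier (\<xi> n) x - ?u x))\<^sup>2 * ?w x = (k n x)\<^sup>2 * ((cmod (?u x))\<^sup>2 * ?w x)"
      proof eventually_elim
        case (elim x)
        have "fourier (\<xi> n) x - ?u x = of_real (- k n x) * ?u x"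
          using F[OF elim] by (simp add: k_def algebra_simps)
        then show ?case by (simp only: norm_mult norm_of_real abs_minus power_mult_distrib power2_abs mult.assoc)
      qed
    qed (simp_all add: k_def)
    have "(\<lambda>n. LINT x|lborel. (k n x)\<^sup>2 * ((cmod (?u x))\<^sup>2 * ?w x)) \<longlonglongrightarrow> (LINT x|lborel. 0\<^sup>2 * ((cmod (?u x))\<^sup>2 * ?w x))"
    proof (rule integral_dominated_convergence[OF _ _ int])
      have "(\<lambda>n. 1 - exp (- (1 / real (Suc n) * x)\<^sup>2 / 2)) \<longlonglongrightarrow> 1 - exp (- (0 * x)\<^sup>2 / 2)" for x
        using LIMSEQ_Suc[OF lim_const_over_n[of 1]] by (intro tendsto_intros) auto
      then have "(\<lambda>n. k n x) \<longlonglongrightarrow> 0" for x by (simp add: k_def)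
      then show "AE x in lborel. (\<lambda>n. (k n x)\<^sup>2 * ((cmod (?u x))\<^sup>2 * ?w x)) \<longlonglongrightarrow> 0\<^sup>2 * ((cmod (?u x))\<^sup>2 * ?w x)"
        by (intro AE_I2 tendsto_intros)
      show "AE x in lborel. norm ((k n x)\<^sup>2 * ((cmod (?u x))\<^sup>2 * ?w x)) \<le> (cmod (?u x))\<^sup>2 * ?w x" for n
        using k by (intro AE_I2) (auto simp: abs_mult intro!: mult_left_le_one_le power_le_one)
    qed (simp_all add: k_def)
    then show ?thesis by (simp add: eq)
  qed
  then have "alpha_tendsto \<alpha> \<xi> ?u"
    unfolding alpha_tendsto_def by (simp add: weighted_norm_tendsto_0_iff[OF \<alpha>])
  with u \<xi> show ?thesis by (auto simp: schwartz_completion_def)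
qed

section \<open>Grey noise\<close>

lemma space_weak_borel: "space weak_borel = schwartz_dual"
  and sets_weak_borel: "openin weak_topology U \<Longrightarrow> U \<in> sets weak_borel"
proof -
  have "topspace weak_topology \<subseteq> schwartz_dual"
    unfolding weak_topology_def topology_generated_by_topspace by auto
  then have "{U. openin weak_topology U} \<subseteq> Pow schwartz_dual"
    using openin_subset[of weak_topology] by blast
  then show "space weak_borel = schwartz_dual" "openin weak_topology U \<Longrightarrow> U \<in> sets weak_borel"
    by (auto simp: weak_borel_def space_measure_of sets_measure_of)
qed

lemma pairing_measurable_weak_borel:
  assumes "\<xi> \<in> schwartz"
  shows "(\<lambda>\<omega>. \<omega> \<xi>) \<in> borel_measurable weak_borel"
proof (rule borel_measurableI)
  fix U :: "real set" assume "open U"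
  then have "openin weak_topology {\<omega> \<in> schwartz_dual. \<omega> \<xi> \<in> U}"
    unfolding weak_topology_def using assms by (intro topology_generated_by_Basis) auto
  moreover have "(\<lambda>\<omega>. \<omega> \<xi>) -` U \<inter> space weak_borel = {\<omega> \<in> schwartz_dual. \<omega> \<xi> \<in> U}"
    by (auto simp: space_weak_borel)
  ultimately show "(\<lambda>\<omega>. \<omega> \<xi>) -` U \<inter> space weak_borel \<in> sets weak_borel"
    by (simp add: sets_weak_borel)
qed

lemma schwartz_dual_lincomb:
  assumes "\<omega> \<in> schwartz_dual" "f \<in> schwartz" "g \<in> schwartz"
  shows "\<omega> (\<lambda>x. a * f x + b * g x) = a * \<omega> f + b * \<omega> g"
  using assms schwartz_cmult[of f a] schwartz_cmult[of g b] by (simp add: schwartz_dual_def)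

locale grey_noise_space = prob_space \<mu> for \<mu> :: "((real \<Rightarrow> real) \<Rightarrow> real) measure" +
  fixes \<alpha> \<beta> :: real
  assumes \<alpha>: "0 < \<alpha>" "\<alpha> < 2" and \<beta>: "0 < \<beta>" and grey: "grey_noise_measure \<alpha> \<beta> \<mu>"
begin

lemma space_\<mu>: "space \<mu> = schwartz_dual"
  using grey sets_eq_imp_space_eq[of \<mu> weak_borel] by (simp add: grey_noise_measure_def space_weak_borel)

lemma pairing_measurable: "\<xi> \<in> schwartz \<Longrightarrow> (\<lambda>\<omega>. \<omega> \<xi>) \<in> borel_measurable \<mu>"
  using pairing_measurable_weak_borel grey by (simp add: grey_noise_measure_def cong: measurable_cong_sets)

lemma char_pairing:
  assumes "\<xi> \<in> schwartz"
  shows "(LINT \<omega>|\<mu>. iexp (\<omega> \<xi>)) = mittag_leffler \<beta> (- (C_alpha \<alpha> * weighted_sq \<alpha> (fourier \<xi>)))"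
proof -
  have "(alpha_norm \<alpha> \<xi>)\<^sup>2 = (weighted_norm \<alpha> (fourier \<xi>))\<^sup>2"
    by (simp add: alpha_norm_def alpha_inner_def weighted_norm_def)
  also have "\<dots> = C_alpha \<alpha> * weighted_sq \<alpha> (fourier \<xi>)"
    using C_alpha_pos[OF \<alpha>] weighted_sq_nonneg[of \<alpha> "fourier \<xi>"] by (simp add: weighted_norm_eq)
  finally show ?thesis using grey assms by (simp add: grey_noise_measure_def)
qed

text \<open>For the scaled function \<xi>/(n+1) the squared norm shrinks by (n+1)^2, so
  \<open>mittag_leffler_quadratic_limit\<close> supplies the limit that
  \<open>second_moment_le_char\<close> turns into a moment bound.\<close>

lemma
  assumes \<xi>: "\<xi> \<in> schwartz"
  shows pairing_L2: "(\<lambda>\<omega>. \<omega> \<xi>) \<in> L2 \<mu>"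
    and pairing_second_moment:
      "expectation (\<lambda>\<omega>. (\<omega> \<xi>)\<^sup>2) \<le> 2 * (C_alpha \<alpha> / Gamma (\<beta> + 1)) * weighted_sq \<alpha> (fourier \<xi>)"
proof -
  let ?r = "C_alpha \<alpha> * weighted_sq \<alpha> (fourier \<xi>)"
  have "expectation (\<lambda>\<omega>. iexp (\<omega> \<xi> / real (Suc n))) = mittag_leffler \<beta> (- (?r / (real (Suc n))\<^sup>2))" for n
  proof -
    \<comment> \<open>The summand \<open>0 * \<xi> x\<close> brings the scalar multiple into the
      shape of the linear combination lemmas.\<close>
    let ?\<eta> = "\<lambda>x. (1 / real (Suc n)) * \<xi> x + 0 * \<xi> x"
    have "expectation (\<lambda>\<omega>. iexp (\<omega> \<xi> / real (Suc n))) = expectation (\<lambda>\<omega>. iexp (\<omega> ?\<eta>))"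
    proof (intro Bochner_Integration.integral_cong refl)
      fix \<omega> assume "\<omega> \<in> space \<mu>"
      then have "\<omega> ?\<eta> = (1 / real (Suc n)) * \<omega> \<xi> + 0 * \<omega> \<xi>"
        using \<xi> by (intro schwartz_dual_lincomb) (simp_all add: space_\<mu>)
      then show "iexp (\<omega> \<xi> / real (Suc n)) = iexp (\<omega> ?\<eta>)" by simp
    qed
    also have "\<dots> = mittag_leffler \<beta> (- (C_alpha \<alpha> * weighted_sq \<alpha> (fourier ?\<eta>)))"
      by (intro char_pairing schwartz_lincomb \<xi>)
    also have "weighted_sq \<alpha> (fourier ?\<eta>) = weighted_sq \<alpha> (fourier \<xi>) / (real (Suc n))\<^sup>2"
    proof -
      have "fourier ?\<eta> = (\<lambda>x. of_real (1 / real (Suc n)) * fourier \<xi> x)"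
        unfolding fourier_schwartz_lincomb[OF \<xi> \<xi>] by simp
      then show ?thesis
        by (simp only: weighted_sq_cmult norm_of_real power2_abs) (simp add: power_divide)
    qed
    finally show ?thesis by simp
  qed
  then have L: "(\<lambda>n. (1 - Re (expectation (\<lambda>\<omega>. iexp (\<omega> \<xi> / real (Suc n))))) * (real (Suc n))\<^sup>2) \<longlonglongrightarrow> ?r / Gamma (\<beta> + 1)"
    using mittag_leffler_quadratic_limit[OF \<beta>, of ?r] by simp
  note * = second_moment_le_char[OF pairing_measurable[OF \<xi>] L]
  show "(\<lambda>\<omega>. \<omega> \<xi>) \<in> L2 \<mu>" using *(1) pairing_measurable[OF \<xi>] by (simp add: L2_def)
  show "expectation (\<lambda>\<omega>. (\<omega> \<xi>)\<^sup>2) \<le> 2 * (C_alpha \<alpha> / Gamma (\<beta> + 1)) * weighted_sq \<alpha> (fourier \<xi>)"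
    using *(2) by simp
qed

text \<open>Makes the pairing Lipschitz from the weighted norm into L2, so that Cauchy sequences and
  limits carry over.\<close>

lemma pairing_diff_second_moment:
  assumes \<xi>: "\<xi> \<in> schwartz" and \<eta>: "\<eta> \<in> schwartz"
  shows "expectation (\<lambda>\<omega>. (\<omega> \<xi> - \<omega> \<eta>)\<^sup>2) \<le>
    2 * (C_alpha \<alpha> / Gamma (\<beta> + 1)) * weighted_sq \<alpha> (\<lambda>x. fourier \<xi> x - fourier \<eta> x)"
proof -
  let ?\<zeta> = "\<lambda>x. 1 * \<xi> x + (- 1) * \<eta> x"
  have "expectation (\<lambda>\<omega>. (\<omega> \<xi> - \<omega> \<eta>)\<^sup>2) = expectation (\<lambda>\<omega>. (\<omega> ?\<zeta>)\<^sup>2)"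
  proof (intro Bochner_Integration.integral_cong refl)
    fix \<omega> assume "\<omega> \<in> space \<mu>"
    then have "\<omega> ?\<zeta> = 1 * \<omega> \<xi> + (- 1) * \<omega> \<eta>"
      using \<xi> \<eta> by (intro schwartz_dual_lincomb) (simp_all add: space_\<mu>)
    then show "(\<omega> \<xi> - \<omega> \<eta>)\<^sup>2 = (\<omega> ?\<zeta>)\<^sup>2" by simp
  qed
  also have "\<dots> \<le> 2 * (C_alpha \<alpha> / Gamma (\<beta> + 1)) * weighted_sq \<alpha> (fourier ?\<zeta>)"
    by (intro pairing_second_moment schwartz_lincomb \<xi> \<eta>)
  also have "fourier ?\<zeta> = (\<lambda>x. fourier \<xi> x - fourier \<eta> x)"
    unfolding fourier_schwartz_lincomb[OF \<xi> \<eta>] by simp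
  finally show ?thesis .
qed

lemma alpha_tendsto_iff:
  "alpha_tendsto \<alpha> \<xi> u \<longleftrightarrow> (\<lambda>n. weighted_sq \<alpha> (\<lambda>x. fourier (\<xi> n) x - u x)) \<longlonglongrightarrow> 0"
  unfolding alpha_tendsto_def by (rule weighted_norm_tendsto_0_iff[OF \<alpha>])

lemma weighted_sq_diff_le:
  assumes "\<xi> \<in> schwartz" "\<eta> \<in> schwartz" "u \<in> weighted_L2 \<alpha>"
  shows "weighted_sq \<alpha> (\<lambda>x. fourier \<xi> x - fourier \<eta> x) \<le>
    2 * weighted_sq \<alpha> (\<lambda>x. fourier \<xi> x - u x) + 2 * weighted_sq \<alpha> (\<lambda>x. fourier \<eta> x - u x)"
proof -
  have "weighted_sq \<alpha> (\<lambda>x. (fourier \<xi> x - u x) + - 1 * (fourier \<eta> x - u x)) \<le>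
    2 * weighted_sq \<alpha> (\<lambda>x. fourier \<xi> x - u x) + 2 * weighted_sq \<alpha> (\<lambda>x. - 1 * (fourier \<eta> x - u x))"
    using assms by (intro weighted_sq_add_le weighted_L2_cmult weighted_L2_diff fourier_schwartz_weighted_L2 \<alpha>)
  then show ?thesis
    unfolding weighted_sq_cmult by (simp add: algebra_simps)
qed

text \<open>Working with all \<open>L\<^sup>2\<close> limits \<open>Y\<close> at once makes linearity available, which the choice
  operator in \<^const>\<open>grey_noise\<close> provides only almost everywhere.\<close>

definition represents :: "(((real \<Rightarrow> real) \<Rightarrow> real) \<Rightarrow> real) \<Rightarrow> (real \<Rightarrow> complex) \<Rightarrow> bool" where
  "represents Y u \<longleftrightarrow> u \<in> weighted_L2 \<alpha> \<and>
     (\<exists>\<xi>. (\<forall>n. \<xi> n \<in> schwartz) \<and> alpha_tendsto \<alpha> \<xi> u \<and> L2_tendsto \<mu> (\<lambda>n \<omega>. \<omega> (\<xi> n)) Y)"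

text \<open>The choice operator asks for one limit valid for all approximating sequences. Along one
  sequence a limit exists by completeness of L2; any other sequence is asymptotically close to the
  first and so has the same limit.\<close>

lemma represents_grey_noise:
  assumes u: "u \<in> schwartz_completion \<alpha>"
  shows "represents (grey_noise \<alpha> \<mu> u) u"
proof -
  define K where "K = 2 * (C_alpha \<alpha> / Gamma (\<beta> + 1))"
  have "K > 0"
    using C_alpha_pos[OF \<alpha>] \<beta> by (simp add: K_def Gamma_real_pos)
  obtain \<xi> where \<xi>: "\<And>n. \<xi> n \<in> schwartz" and lim: "alpha_tendsto \<alpha> \<xi> u" and uL2: "u \<in> weighted_L2 \<alpha>"
    using u by (auto simp: schwartz_completion_def)
  let ?q = "\<lambda>\<xi>. weighted_sq \<alpha> (\<lambda>x. fourier \<xi> x - u x)"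
  have diff: "expectation (\<lambda>\<omega>. (\<omega> \<zeta> - \<omega> \<eta>)\<^sup>2) \<le> 2 * K * ?q \<zeta> + 2 * K * ?q \<eta>" if "\<zeta> \<in> schwartz" "\<eta> \<in> schwartz" for \<zeta> \<eta>
  proof -
    have "expectation (\<lambda>\<omega>. (\<omega> \<zeta> - \<omega> \<eta>)\<^sup>2) \<le> K * weighted_sq \<alpha> (\<lambda>x. fourier \<zeta> x - fourier \<eta> x)"
      unfolding K_def by (rule pairing_diff_second_moment[OF that])
    also have "\<dots> \<le> K * (2 * ?q \<zeta> + 2 * ?q \<eta>)"
      using \<open>K > 0\<close> by (intro mult_left_mono weighted_sq_diff_le that uL2) auto
    finally show ?thesis by (simp add: algebra_simps)
  qed
  have q0: "(\<lambda>n. 2 * K * ?q (\<eta> n)) \<longlonglongrightarrow> 0" if "alpha_tendsto \<alpha> \<eta> u" for \<eta>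
    using that unfolding alpha_tendsto_iff by (rule tendsto_mult_right_zero)
  obtain Y where Y: "L2_tendsto \<mu> (\<lambda>n \<omega>. \<omega> (\<xi> n)) Y"
  proof (rule L2_Cauchy_imp_convergent)
    show "(\<lambda>\<omega>. \<omega> (\<xi> n)) \<in> L2 \<mu>" for n by (rule pairing_L2[OF \<xi>])
    fix e :: real assume "e > 0"
    then have "\<forall>\<^sub>F n in sequentially. 2 * K * ?q (\<xi> n) < e / 2"
      by (intro order_tendstoD[OF q0[OF lim]]) simp
    then obtain N where N: "\<And>n. n \<ge> N \<Longrightarrow> 2 * K * ?q (\<xi> n) < e / 2"
      unfolding eventually_sequentially by blast
    have "expectation (\<lambda>\<omega>. (\<omega> (\<xi> m) - \<omega> (\<xi> n))\<^sup>2) < e" if "m \<ge> N" "n \<ge> N" for m n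
      using diff[OF \<xi>[of m] \<xi>[of n]] N[OF that(1)] N[OF that(2)] by linarith
    then show "\<exists>N. \<forall>m\<ge>N. \<forall>n\<ge>N. expectation (\<lambda>\<omega>. (\<omega> (\<xi> m) - \<omega> (\<xi> n))\<^sup>2) < e" by blast
  qed
  have "L2_tendsto \<mu> (\<lambda>n \<omega>. \<omega> (\<eta> n)) Y" if \<eta>: "\<And>n. \<eta> n \<in> schwartz" "alpha_tendsto \<alpha> \<eta> u" for \<eta>
  proof (rule L2_tendsto_cong_limit[OF Y pairing_L2[OF \<eta>(1)]])
    have lim0: "(\<lambda>n. 2 * K * ?q (\<eta> n) + 2 * K * ?q (\<xi> n)) \<longlonglongrightarrow> 0"
      by (intro tendsto_add_zero q0 lim \<eta>(2))
    show "(\<lambda>n. expectation (\<lambda>\<omega>. (\<omega> (\<eta> n) - \<omega> (\<xi> n))\<^sup>2)) \<longlonglongrightarrow> 0"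
      by (rule tendsto_sandwich[OF _ _ tendsto_const lim0])
         (intro always_eventually allI diff \<eta> \<xi> integral_nonneg_AE AE_I2 zero_le_power2)+
  qed
  with u have "\<exists>Y. u \<in> schwartz_completion \<alpha> \<and> (\<forall>\<xi>. (\<forall>n. \<xi> n \<in> schwartz) \<and> alpha_tendsto \<alpha> \<xi> u \<longrightarrow>
        L2_tendsto \<mu> (\<lambda>n \<omega>. \<omega> (\<xi> n)) Y)" by blast
  from someI_ex[OF this] have "L2_tendsto \<mu> (\<lambda>n \<omega>. \<omega> (\<xi> n)) (grey_noise \<alpha> \<mu> u)"
    unfolding grey_noise_def[symmetric] using \<xi> lim by blast
  with \<xi> lim uL2 show ?thesis by (auto simp: represents_def)
qed

lemma represents_borel_measurable: "represents Y u \<Longrightarrow> Y \<in> borel_measurable \<mu>"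
  by (auto simp: represents_def L2_tendsto_def L2_def)

lemma represents_lincomb:
  assumes Y: "represents Y u" and Z: "represents Z v"
  shows "represents (\<lambda>\<omega>. a * Y \<omega> + b * Z \<omega>) (\<lambda>x. of_real a * u x + of_real b * v x)"
proof -
  obtain \<xi> \<eta> where \<xi>: "\<And>n. \<xi> n \<in> schwartz" "alpha_tendsto \<alpha> \<xi> u" "L2_tendsto \<mu> (\<lambda>n \<omega>. \<omega> (\<xi> n)) Y"
    and \<eta>: "\<And>n. \<eta> n \<in> schwartz" "alpha_tendsto \<alpha> \<eta> v" "L2_tendsto \<mu> (\<lambda>n \<omega>. \<omega> (\<eta> n)) Z"
    and uv: "u \<in> weighted_L2 \<alpha>" "v \<in> weighted_L2 \<alpha>"
    using Y Z by (auto simp: represents_def)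
  let ?\<zeta> = "\<lambda>n x. a * \<xi> n x + b * \<eta> n x"
  let ?w = "\<lambda>x. of_real a * u x + of_real b * v x"
  have "?\<zeta> n \<in> schwartz" for n by (intro schwartz_lincomb \<xi> \<eta>)
  moreover have "?w \<in> weighted_L2 \<alpha>" by (intro weighted_L2_add weighted_L2_cmult uv)
  moreover have "alpha_tendsto \<alpha> ?\<zeta> ?w"
    unfolding alpha_tendsto_iff
  proof (rule tendsto_sandwich[OF _ _ tendsto_const])
    let ?d = "\<lambda>n x. fourier (\<xi> n) x - u x" and ?e = "\<lambda>n x. fourier (\<eta> n) x - v x"
    show "(\<lambda>n. 2 * (a\<^sup>2 * weighted_sq \<alpha> (?d n)) + 2 * (b\<^sup>2 * weighted_sq \<alpha> (?e n))) \<longlonglongrightarrow> 0"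
      using \<xi>(2) \<eta>(2) unfolding alpha_tendsto_iff by (intro tendsto_add_zero tendsto_mult_right_zero)
    have "weighted_sq \<alpha> (\<lambda>x. fourier (?\<zeta> n) x - ?w x) \<le> 2 * (a\<^sup>2 * weighted_sq \<alpha> (?d n)) + 2 * (b\<^sup>2 * weighted_sq \<alpha> (?e n))" for n
    proof -
      have "weighted_sq \<alpha> (\<lambda>x. fourier (?\<zeta> n) x - ?w x) = weighted_sq \<alpha> (\<lambda>x. of_real a * ?d n x + of_real b * ?e n x)"
        unfolding fourier_schwartz_lincomb[OF \<xi>(1) \<eta>(1)]
        by (intro arg_cong[where f = "weighted_sq \<alpha>"]) (auto simp: algebra_simps)
      also have "\<dots> \<le> 2 * weighted_sq \<alpha> (\<lambda>x. of_real a * ?d n x) + 2 * weighted_sq \<alpha> (\<lambda>x. of_real b * ?e n x)"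
        by (intro weighted_sq_add_le weighted_L2_cmult weighted_L2_diff fourier_schwartz_weighted_L2 \<alpha> \<xi> \<eta> uv)
      finally show ?thesis unfolding weighted_sq_cmult by simp
    qed
    then show "\<forall>\<^sub>F n in sequentially. weighted_sq \<alpha> (\<lambda>x. fourier (?\<zeta> n) x - ?w x) \<le> 2 * (a\<^sup>2 * weighted_sq \<alpha> (?d n)) + 2 * (b\<^sup>2 * weighted_sq \<alpha> (?e n))"
      by (intro always_eventually allI)
  qed (simp add: weighted_sq_nonneg)
  moreover have "L2_tendsto \<mu> (\<lambda>n \<omega>. \<omega> (?\<zeta> n)) (\<lambda>\<omega>. a * Y \<omega> + b * Z \<omega>)"
    by (rule L2_tendsto_cong[OF L2_tendsto_lincomb[OF \<xi>(3) \<eta>(3)]])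
       (intro schwartz_dual_lincomb \<xi> \<eta>, simp add: space_\<mu>)
  ultimately show ?thesis unfolding represents_def by (intro conjI exI[of _ ?\<zeta>] allI)
qed

text \<open>For Schwartz functions this is the defining property of \<mu>. The left side passes to
  the limit by \<open>L2_tendsto_iexp\<close>, the right side by continuity of the weighted norm and
  of E_\<beta>.\<close>

lemma represents_char:
  assumes "represents Y u"
  shows "(LINT \<omega>|\<mu>. iexp (Y \<omega>)) = mittag_leffler \<beta> (- (C_alpha \<alpha> * weighted_sq \<alpha> u))"
proof -
  obtain \<xi> where \<xi>: "\<And>n. \<xi> n \<in> schwartz" "alpha_tendsto \<alpha> \<xi> u" "L2_tendsto \<mu> (\<lambda>n \<omega>. \<omega> (\<xi> n)) Y"
    and u: "u \<in> weighted_L2 \<alpha>"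
    using assms by (auto simp: represents_def)
  have "(\<lambda>n. weighted_sq \<alpha> (fourier (\<xi> n))) \<longlonglongrightarrow> weighted_sq \<alpha> u"
    using \<xi>(2) unfolding alpha_tendsto_iff
    by (intro weighted_sq_tendsto u fourier_schwartz_weighted_L2 \<alpha> \<xi>(1))
  then have "(\<lambda>n. complex_of_real (mittag_leffler \<beta> (- (C_alpha \<alpha> * weighted_sq \<alpha> (fourier (\<xi> n)))))) \<longlonglongrightarrow>
      complex_of_real (mittag_leffler \<beta> (- (C_alpha \<alpha> * weighted_sq \<alpha> u)))"
    by (intro tendsto_of_real isCont_tendsto_compose[OF isCont_mittag_leffler[OF \<beta>]] tendsto_minus tendsto_mult tendsto_const)
  moreover have "(\<lambda>n. LINT \<omega>|\<mu>. iexp (\<omega> (\<xi> n))) \<longlonglongrightarrow> (LINT \<omega>|\<mu>. iexp (Y \<omega>))"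
    by (rule L2_tendsto_iexp[OF prob_space_axioms \<xi>(3)])
  ultimately show ?thesis
    unfolding char_pairing[OF \<xi>(1)] by (rule LIMSEQ_unique[symmetric])
qed

section \<open>Grey Brownian motion\<close>

lemma represents_grey_Brownian_motion:
  "t \<ge> 0 \<Longrightarrow> represents (grey_Brownian_motion \<alpha> \<mu> t) (fourier (indicat_real {0..<t}))"
  unfolding grey_Brownian_motion_def
  by (intro represents_grey_noise fourier_indicator_in_schwartz_completion \<alpha>)

lemma represents_sum:
  assumes "finite J" "\<And>j. j \<in> J \<Longrightarrow> represents (Y j) (u j)"
  shows "represents (\<lambda>\<omega>. \<Sum>j\<in>J. c j * Y j \<omega>) (\<lambda>x. \<Sum>j\<in>J. of_real (c j) * u j x)"
  using assms
proof (induction J)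
  case empty
  \<comment> \<open>The zero function is obtained as 0 * B(0) + 0 * B(0).\<close>
  show ?case
    using represents_lincomb[OF represents_grey_Brownian_motion represents_grey_Brownian_motion, of 0 0 0 0] by simp
next
  case (insert i J)
  then show ?case
    using represents_lincomb[of "Y i" "u i" "\<lambda>\<omega>. \<Sum>j\<in>J. c j * Y j \<omega>" "\<lambda>x. \<Sum>j\<in>J. of_real (c j) * u j x" "c i" 1] by simp
qed

text \<open>By \<open>represents_char\<close> the characteristic function of a linear combination
  depends only on \<open>weighted_sq\<close> of the same combination of transforms.\<close>

lemma represents_same_fdd:
  assumes X: "\<And>t. t \<ge> 0 \<Longrightarrow> represents (X t) (u t)" and Y: "\<And>t. t \<ge> 0 \<Longrightarrow> represents (Y t) (v t)"
    and eq: "\<And>J c. finite J \<Longrightarrow> J \<subseteq> {0..} \<Longrightarrow>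
      weighted_sq \<alpha> (\<lambda>x. \<Sum>t\<in>J. of_real (c t) * u t x) = weighted_sq \<alpha> (\<lambda>x. \<Sum>t\<in>J. of_real (c t) * v t x)"
  shows "same_fdd \<mu> X Y"
  unfolding same_fdd_def
proof (intro conjI allI impI)
  show "X t \<in> borel_measurable \<mu>" "Y t \<in> borel_measurable \<mu>" if "t \<ge> 0" for t
    using X Y that by (auto intro: represents_borel_measurable)
  fix J :: "real set" assume J: "finite J \<and> J \<subseteq> {0..}"
  show "distr \<mu> (\<Pi>\<^sub>M t\<in>J. borel) (\<lambda>\<omega>. \<lambda>t\<in>J. X t \<omega>) = distr \<mu> (\<Pi>\<^sub>M t\<in>J. borel) (\<lambda>\<omega>. \<lambda>t\<in>J. Y t \<omega>)"
  proof (rule distr_PiM_eqI_char[OF prob_space_axioms prob_space_axioms])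
    show "finite J" using J by simp
    show "X j \<in> borel_measurable \<mu>" "Y j \<in> borel_measurable \<mu>" if "j \<in> J" for j
      using X Y that J by (auto intro: represents_borel_measurable)
    fix c
    have "represents (\<lambda>\<omega>. \<Sum>j\<in>J. c j * X j \<omega>) (\<lambda>x. \<Sum>j\<in>J. of_real (c j) * u j x)"
      "represents (\<lambda>\<omega>. \<Sum>j\<in>J. c j * Y j \<omega>) (\<lambda>x. \<Sum>j\<in>J. of_real (c j) * v j x)"
      using J X Y by (auto intro!: represents_sum)
    then show "(LINT \<omega>|\<mu>. iexp (\<Sum>j\<in>J. c j * X j \<omega>)) = (LINT \<omega>|\<mu>. iexp (\<Sum>j\<in>J. c j * Y j \<omega>))"
      using J by (simp only: represents_char eq)
  qed
qed

lemma self_similar_grey_Brownian_motion: "self_similar (\<alpha> / 2) \<mu> (grey_Brownian_motion \<alpha> \<mu>)"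
  unfolding self_similar_def
proof (intro allI impI)
  fix a :: real assume a: "a > 0"
  let ?u = "\<lambda>t. fourier (indicat_real {0..<t})" and ?k = "a powr (\<alpha> / 2)"
  have dilate: "?u (a * t) x = of_real a * ?u t (a * x)" for t x
  proof -
    have "indicat_real {0..<a * t} = (\<lambda>y. indicat_real {0..<t} (y / a))"
      using a by (auto simp: indicator_def fun_eq_iff field_simps)
    then show ?thesis using fourier_scale[OF a, of "indicat_real {0..<t}" x] by simp
  qed
  show "same_fdd \<mu> (\<lambda>t. grey_Brownian_motion \<alpha> \<mu> (a * t)) (\<lambda>t \<omega>. ?k * grey_Brownian_motion \<alpha> \<mu> t \<omega>)"
  proof (rule represents_same_fdd)
    fix t :: real assume t: "t \<ge> 0"
    show "represents (grey_Brownian_motion \<alpha> \<mu> (a * t)) (?u (a * t))"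
      using a t by (intro represents_grey_Brownian_motion) simp
    show "represents (\<lambda>\<omega>. ?k * grey_Brownian_motion \<alpha> \<mu> t \<omega>) (\<lambda>x. of_real ?k * ?u t x)"
      using represents_lincomb[OF represents_grey_Brownian_motion[OF t] represents_grey_Brownian_motion[OF t], of ?k 0] by simp
  next
    fix J :: "real set" and c :: "real \<Rightarrow> real"
    have "weighted_sq \<alpha> (\<lambda>x. \<Sum>t\<in>J. of_real (c t) * ?u (a * t) x) =
        weighted_sq \<alpha> (\<lambda>x. of_real a * (\<Sum>t\<in>J. of_real (c t) * ?u t (a * x)))"
      by (simp only: dilate sum_distrib_left mult.left_commute)
    also have "\<dots> = a powr \<alpha> * weighted_sq \<alpha> (\<lambda>x. \<Sum>t\<in>J. of_real (c t) * ?u t x)"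
      by (rule weighted_sq_dilation[OF a])
    \<comment> \<open>The self-similarity exponent is half of \<alpha> because the norm enters the
      characteristic function through its square.\<close>
    also have "a powr \<alpha> = (cmod (of_real ?k))\<^sup>2"
      using a by (simp add: power2_eq_square powr_add[symmetric])
    also have "\<dots> * weighted_sq \<alpha> (\<lambda>x. \<Sum>t\<in>J. of_real (c t) * ?u t x) =
        weighted_sq \<alpha> (\<lambda>x. of_real ?k * (\<Sum>t\<in>J. of_real (c t) * ?u t x))"
      by (rule weighted_sq_cmult[symmetric])
    also have "\<dots> = weighted_sq \<alpha> (\<lambda>x. \<Sum>t\<in>J. of_real (c t) * (of_real ?k * ?u t x))"
      by (simp add: sum_distrib_left mult_ac)
    finally show "weighted_sq \<alpha> (\<lambda>x. \<Sum>t\<in>J. of_real (c t) * ?u (a * t) x) =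
        weighted_sq \<alpha> (\<lambda>x. \<Sum>t\<in>J. of_real (c t) * (of_real ?k * ?u t x))" .
  qed
qed

lemma stationary_increments_grey_Brownian_motion: "stationary_increments \<mu> (grey_Brownian_motion \<alpha> \<mu>)"
  unfolding stationary_increments_def
proof (intro allI impI)
  fix h :: real assume h: "h \<ge> 0"
  let ?u = "\<lambda>t. fourier (indicat_real {0..<t})"
  have increment: "?u (t + h) x - ?u h x = iexp (x * h) * (?u t x - ?u 0 x)" if "t \<ge> 0" for t x
  proof -
    have "?u (t + h) x - ?u h x = fourier (\<lambda>y. 1 * indicat_real {0..<t + h} y + (- 1) * indicat_real {0..<h} y) x"
      by (subst fourier_lincomb) (auto intro: integrable_indicator_interval)
    \<comment> \<open>Both sides are the indicator of [h, t + h); half-open intervals make the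
      identity exact at the endpoints.\<close>
    also have "(\<lambda>y. 1 * indicat_real {0..<t + h} y + (- 1) * indicat_real {0..<h} y) = (\<lambda>y. indicat_real {0..<t} (y - h))"
      using h that by (auto simp: indicator_def fun_eq_iff)
    also have "fourier \<dots> x = iexp (x * h) * ?u t x" by (rule fourier_shift)
    \<comment> \<open>The interval [0, 0) is empty, so \<open>?u 0\<close> vanishes. It is kept to
      match the increment from B(0), which the choice operator fixes only up to a null set.\<close>
    also have "?u 0 x = 0" by (simp add: fourier_def)
    then have "?u t x = ?u t x - ?u 0 x" by simp
    finally show ?thesis .
  qed
  have diff: "represents (\<lambda>\<omega>. grey_Brownian_motion \<alpha> \<mu> s \<omega> - grey_Brownian_motion \<alpha> \<mu> t \<omega>) (\<lambda>x. ?u s x - ?u t x)"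
    if "s \<ge> 0" "t \<ge> 0" for s t
    using represents_lincomb[OF that[THEN represents_grey_Brownian_motion], of 1 "- 1"] by simp
  show "same_fdd \<mu> (\<lambda>t \<omega>. grey_Brownian_motion \<alpha> \<mu> (t + h) \<omega> - grey_Brownian_motion \<alpha> \<mu> h \<omega>)
      (\<lambda>t \<omega>. grey_Brownian_motion \<alpha> \<mu> t \<omega> - grey_Brownian_motion \<alpha> \<mu> 0 \<omega>)"
  proof (rule represents_same_fdd)
    fix J :: "real set" and c :: "real \<Rightarrow> real" assume J: "J \<subseteq> {0..}"
    have "(\<Sum>t\<in>J. of_real (c t) * (?u (t + h) x - ?u h x)) = iexp (x * h) * (\<Sum>t\<in>J. of_real (c t) * (?u t x - ?u 0 x))" for x
      unfolding sum_distrib_left using J by (intro sum.cong refl) (auto simp: increment)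
    then show "weighted_sq \<alpha> (\<lambda>x. \<Sum>t\<in>J. of_real (c t) * (?u (t + h) x - ?u h x)) =
        weighted_sq \<alpha> (\<lambda>x. \<Sum>t\<in>J. of_real (c t) * (?u t x - ?u 0 x))"
      by (simp add: weighted_sq_def norm_mult)
  qed (intro diff add_nonneg_nonneg h order_refl; assumption)+
qed

end

theorem proposition3p2:
  fixes \<alpha> \<beta> :: real and \<mu> :: "((real \<Rightarrow> real) \<Rightarrow> real) measure"
  assumes "0 < \<alpha>" and "\<alpha> < 2" and "0 < \<beta>" and "\<beta> \<le> 1"
    and "grey_noise_measure \<alpha> \<beta> \<mu>"
  shows "sssi (\<alpha> / 2) \<mu> (grey_Brownian_motion \<alpha> \<mu>)"
proof -
  interpret prob_space \<mu> using assms(5) by (simp add: grey_noise_measure_def)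
  interpret grey_noise_space \<mu> \<alpha> \<beta> by unfold_locales (use assms in auto)
  show ?thesis
    unfolding sssi_def
    by (intro conjI self_similar_grey_Brownian_motion stationary_increments_grey_Brownian_motion)
qed

end
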